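(* Let $1/2<p<1$ and consider the infinite-colour urn process with parameter $p$. Almost surely there is a dominating colour; that is, with probability $1$ there exist a (random) colour $c$ and a (random) finite time $n_0$ such that for every $n\ge n_0$ the colour $c$ has the most balls in the urn at time $n$, i.e. strictly more balls than every other colour.
   Context: Infinite-colour urn process with parameter $p$: at time $0$ the urn contains a single ball of some colour. At each time step $n\ge 1$, a ball is chosen uniformly at random from the urn, independently of the past given the current content. With probability $p$ the ball is returned to the urn along with another ball of the same colour; with probability $1-p$ the ball is recoloured with a brand new colour (one that has never appeared before) and returned to the urn. A colour whose last ball is recoloured never appears again. *)

theory Defs
  imports "HOL-Probability.Probability" "HOL-Library.Multiset"
begin

(*
  U n w is the content of the urn at time n in the outcome w: a multiset of colours, one occurrence
  per ball. The two transition rules give the conditional law of U (Suc n) given the whole past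
  U 0, ..., U n. A colour c is drawn with probability count / size of the current content, and the
  drawn ball is then reinforced (probability p) or recoloured (probability 1 - p). The conditioning
  is only on histories x of positive probability, which loses nothing because there are only
  countably many finite histories.

  Which new label d is used in a recolouring is left open; the rule only requires that d does not
  occur at any time up to n. Since d is new, the event "U (Suc n) = x n - {#c#} + {#d#} for some
  new d" determines c, so the events in the two rules, for c ranging over the colours present at
  time n, are pairwise disjoint and their probabilities add up to 1.
*)
locale infinite_colour_urn = prob_space M
  for M :: "'w measure" +
  fixes p :: real
    and U :: "nat \<Rightarrow> 'w \<Rightarrow> 'c::countable multiset"
  assumes measurable_U: "\<And>n. U n \<in> measurable M (count_space UNIV)"
    and start: "AE w in M. \<exists>c. U 0 w = {#c#}"
    and reinforce: "\<And>n x c.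
      \<P>(w in M. \<forall>m\<le>n. U m w = x m) > 0 \<Longrightarrow> c \<in># x n \<Longrightarrow>
      \<P>(w in M. U (Suc n) w = x n + {#c#} \<bar> \<forall>m\<le>n. U m w = x m)
        = p * (real (count (x n) c) / real (size (x n)))"
    and recolour: "\<And>n x c.
      \<P>(w in M. \<forall>m\<le>n. U m w = x m) > 0 \<Longrightarrow> c \<in># x n \<Longrightarrow>
      \<P>(w in M. \<exists>d. d \<notin> (\<Union>m\<le>n. set_mset (x m)) \<and> U (Suc n) w = x n - {#c#} + {#d#}
           \<bar> \<forall>m\<le>n. U m w = x m)
        = (1 - p) * (real (count (x n) c) / real (size (x n)))"

definition has_most_balls :: "'c \<Rightarrow> 'c multiset \<Rightarrow> bool" where
  "has_most_balls c A \<longleftrightarrow> (\<forall>d. d \<noteq> c \<longrightarrow> count A d < count A c)"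

end

theory Submission
  imports Defs "HOL-Real_Asymp.Real_Asymp"
begin

text \<open>
  Every estimate comes from a nonnegative supermartingale that depends only on the counts of one or
  two colours already present, via the maximal inequality on cylinder sets of histories. Let
  $\mu = 2p - 1$.

  One colour: with $b = 2/\mu$ and a small $\beta > 0$, $(n+1)^\beta / (X_n + b)$ is a
  supermartingale while the colour is alive. Hence a present colour dies out with probability at
  most $b/(1+b) < 1$ whatever the past, so almost surely some colour survives; and the count of a
  surviving colour is at least a positive multiple of $n^\beta$.

  Two colours: with $T = X + Y$ and $D = X - Y$, the function $T^\gamma e^{-\theta D^2 / T}$ is a
  supermartingale for large $T$ when $\theta$ and $\gamma$ are small. It equals $T^\gamma$ at a tie,
  so ties at large $T$ occur only finitely often. Started from $X = a$, $Y = 1$ it is exponentially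
  small in $a$, so by Borel--Cantelli only finitely many new colours ever catch up with a surviving
  one. That leaves finitely many competitors, and these are eventually strictly ordered.
\<close>

section \<open>Real estimates\<close>

text \<open>The obstacle is that infinitely many colours appear, so comparing colours two at a time
  is not enough. Late colours are controlled uniformly: one step creates at most one colour, with a
  single ball, and the polynomial growth of a survivor makes the probabilities of being caught
  summable. The shift b keeps 1/(X + b) finite at death, so it can be compared with its value there;
  b = 2/mu is large enough for the upward drift to beat the convexity term even at X = 1. Without
  the factor T^\<gamma> the potential would be 1 at every tie and would only bound the probability
  of a tie by a constant. The factor is affordable because the fluctuation of D lowers the
  exponential by order \<theta>/T, more than the cost mu \<gamma>/T when \<gamma> = \<theta>/4. The
  survivor need not win; it is a yardstick. Two colours that stay small may never be ordered, so
  only the survivor and the colours eventually above it are ranked among each other.\<close>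

lemma exp_le_quadratic:
  fixes x :: real
  assumes "x \<le> 1"
  shows "exp x \<le> 1 + x + x\<^sup>2"
proof (cases "x \<ge> 0")
  case True
  then show ?thesis using exp_bound assms by simp
next
  case False
  \<comment> \<open>\<open>exp_bound\<close> covers [0, 1] only. For negative x one has exp x <= 1 /
    (1 - x), and this identity with x^3 < 0 compares that with the quadratic.\<close>
  have "(1 - x) * (1 + x + x\<^sup>2) = 1 - x ^ 3"
    by (simp add: algebra_simps power2_eq_square power3_eq_cube)
  moreover have "x ^ 3 < 0"
    using False by (simp add: power_less_zero_eq)
  ultimately have "1 \<le> (1 + x + x\<^sup>2) * (1 - x)"
    by (simp only: mult.commute)
  then have "1 / (1 - x) \<le> 1 + x + x\<^sup>2"
    using False by (simp add: pos_divide_le_eq)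
  moreover have "exp x \<le> 1 / (1 - x)"
    using exp_ge_add_one_self[of "-x"] False
    by (simp add: exp_minus field_simps)
  ultimately show ?thesis by linarith
qed

text \<open>Moment generating function of a random sign with mean s. The sign will record which of
  two colours was drawn. The quadratic terms combine because the two weights add up to 1.\<close>

lemma two_point_mgf_le:
  fixes s z :: real
  assumes "\<bar>s\<bar> \<le> 1" "\<bar>z\<bar> \<le> 1"
  shows "(1 + s) / 2 * exp (- z) + (1 - s) / 2 * exp z \<le> exp (z\<^sup>2 - s * z)"
proof -
  have "(1 + s) / 2 * exp (- z) \<le> (1 + s) / 2 * (1 - z + z\<^sup>2)"
    using exp_le_quadratic[of "-z"] assms by (intro mult_left_mono) auto
  moreover have "(1 - s) / 2 * exp z \<le> (1 - s) / 2 * (1 + z + z\<^sup>2)"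
    using exp_le_quadratic[of "z"] assms by (intro mult_left_mono) auto
  moreover have "(1 + s) / 2 * (1 - z + z\<^sup>2) + (1 - s) / 2 * (1 + z + z\<^sup>2) = 1 + (z\<^sup>2 - s * z)"
    by (simp add: field_simps)
  ultimately show ?thesis using exp_ge_add_one_self[of "z\<^sup>2 - s * z"] by linarith
qed

text \<open>Concavity of ln. The increment h may be negative because a recolouring lowers the total
  of two counts.\<close>

lemma powr_add_le:
  fixes t g :: real
  assumes "t > 0" "t + h > 0" "g \<ge> 0"
  shows "(t + h) powr g \<le> t powr g * exp (g * h / t)"
proof -
  have "ln (t + h) \<le> ln t + h / t"
    using assms ln_le_minus_one[of "(t + h) / t"] by (simp add: ln_div field_simps)
  then have "g * ln (t + h) \<le> g * ln t + g * h / t"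
    using assms(3) mult_left_mono[of "ln (t + h)" "ln t + h / t" g] by (simp add: algebra_simps)
  then show ?thesis using assms by (simp add: powr_def flip: exp_add)
qed

text \<open>
  The generator of the birth--death chain of one colour, applied to $x \mapsto 1/(x+b)$.
\<close>

lemma recip_shift_drift:
  fixes m x :: real and p :: real
  assumes p: "p < 1" and m: "m = 2 * p - 1" "m > 0" and x: "x \<ge> 1" and b: "b = 2 / m"
  shows "x * (p / (x + 1 + b) + (1 - p) / (x - 1 + b) - 1 / (x + b)) \<le> - (m / (2 * (1 + b))) / (x + b)"
proof -
  define z where "z = x + b"
  have m1: "m < 1" using p m by simp
  have b0: "b > 2" unfolding b using m m1 by (simp add: field_simps)
  have z: "z > 3" unfolding z_def using b0 x by simp
  \<comment> \<open>This is what b = 2 / m buys: the numerator 1 - m * z is at most - m * z / 2,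
    even at x = 1, where a recolouring kills the colour.\<close>
  have mz: "m * z \<ge> 2"
  proof -
    have "m * z = m * x + 2" unfolding z_def b using m by (simp add: algebra_simps)
    then show ?thesis using m x by simp
  qed
  have z2: "z * z > 1" using z by (smt (verit) mult_less_cancel_left1)
  have "p / (x + 1 + b) + (1 - p) / (x - 1 + b) - 1 / (x + b)
      = p / (z + 1) + (1 - p) / (z - 1) - 1 / z"
    unfolding z_def by (simp add: add_ac diff_add_eq)
  also have "\<dots> = (1 - m * z) / ((z * z - 1) * z)"
    using z z2 unfolding m(1)
    by (simp add: divide_simps) (simp add: algebra_simps)
  also have "\<dots> \<le> - (m / 2) / (z * z)"
  proof -
    have "m * (z * z - 1) \<le> 2 * z * (m * z - 1)"
    proof -
      have "m * z * z \<ge> 2 * z" using mz z by simp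
      then show ?thesis using m(2) by (simp add: right_diff_distrib mult.assoc mult.left_commute)
    qed
    then show ?thesis using z z2
      by (simp add: divide_simps) (simp add: algebra_simps)
  qed
  finally have "x * (p / (x + 1 + b) + (1 - p) / (x - 1 + b) - 1 / (x + b)) \<le> x * (- (m / 2) / (z * z))"
    using x by (intro mult_left_mono) auto
  also have "\<dots> = - (m / 2) * (x / z) / z" by (simp add: mult_ac)
  \<comment> \<open>x / (x + b) is smallest at x = 1, which makes the rate independent of x.\<close>
  also have "\<dots> \<le> - (m / 2) * (1 / (1 + b)) / z"
  proof -
    have "1 / (1 + b) \<le> x / z" unfolding z_def using b0 x by (simp add: field_simps)
    then have "- (m / 2) * (x / z) \<le> - (m / 2) * (1 / (1 + b))"
      using m(2) by (intro mult_left_mono_neg) auto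
    then show ?thesis using z by (intro divide_right_mono) auto
  qed
  finally show ?thesis by (simp add: z_def)
qed

definition tie_potential :: "real \<Rightarrow> real \<Rightarrow> real \<Rightarrow> real \<Rightarrow> real" where
  "tie_potential \<theta> \<gamma> t d = t powr \<gamma> * exp (- \<theta> * d\<^sup>2 / t)"

text \<open>
  Here $d$ and $t$ are the difference and the sum of two counts, so $(1 \pm d/t)/2$ are the
  probabilities that a ball drawn from these two colours has the first or the second one.
  The drift $\mu\theta d^2/t^2 + \theta/t$ that is gained beats both the second-order terms, which
  are of order $\theta^2 (d^2/t^2 + 1/t)$, and the loss $\mu\gamma/t$ caused by $t^\gamma$.
\<close>

lemma tie_potential_drift:
  fixes p t d \<theta> \<gamma> m :: real
  assumes p: "p < 1" and m: "m = 2 * p - 1" "m > 0" and th: "\<theta> = m / 64" "\<gamma> = \<theta> / 4"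
    and t: "t \<ge> 4" "t \<ge> 1 / m" and d: "\<bar>d\<bar> \<le> t"
  shows "(1 + d / t) / 2 * (p * tie_potential \<theta> \<gamma> (t + 1) (d + 1)
            + (1 - p) * tie_potential \<theta> \<gamma> (t - 1) (d - 1))
       + (1 - d / t) / 2 * (p * tie_potential \<theta> \<gamma> (t + 1) (d - 1)
            + (1 - p) * tie_potential \<theta> \<gamma> (t - 1) (d + 1))
       \<le> tie_potential \<theta> \<gamma> t d"
proof -
  define s where "s = d / t"
  define c where "c = \<theta> * s\<^sup>2"
  have m1: "m < 1" using p m by simp
  have th0: "\<theta> > 0" "\<gamma> > 0" "\<theta> \<le> 1 / 64" using m m1 th by auto
  have t0: "t > 0" using t by simp
  have s1: "\<bar>s\<bar> \<le> 1" unfolding s_def using d t0 by (simp add: divide_le_eq_1)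
  have ds: "d = s * t" unfolding s_def using t0 by simp
  have s2: "s\<^sup>2 \<le> 1" "s\<^sup>2 \<ge> 0" using s1 by (auto simp: abs_square_le_1)
  have c0: "c \<ge> 0" "c \<le> \<theta>" unfolding c_def using th0 s2 by (auto simp: mult_le_cancel_left1)
  \<comment> \<open>\<open>a\<close> and \<open>e\<close> bound the change of the logarithm of the
    potential when the total rises or falls by one. The terms -c and c are the changes of - \<theta>
    * d^2 / t when d moves by its mean, w comes from the variance 1 - s^2, 8 * \<theta> * c from
    z^2, and \<gamma> / t from the power of t.\<close>
  define w where "w = \<theta> * (1 - s\<^sup>2) / (t + 1)"
  define a where "a = - c + 8 * \<theta> * c - w + \<gamma> / t"
  define e where "e = c + 8 * \<theta> * c - w - \<gamma> / t"
  define v where "v = tie_potential \<theta> \<gamma> t d"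
  have up: "(1 + s) / 2 * tie_potential \<theta> \<gamma> (t + 1) (d + 1)
           + (1 - s) / 2 * tie_potential \<theta> \<gamma> (t + 1) (d - 1) \<le> v * exp a"
  proof -
    \<comment> \<open>Both outcomes share d^2 + 1 in the exponent; z is the cross term of the
      square, which reduces the expectation to \<open>two_point_mgf_le\<close>.\<close>
    define z where "z = 2 * \<theta> * d / (t + 1)"
    have zb: "\<bar>z\<bar> \<le> 1"
    proof -
      have "\<bar>z\<bar> = 2 * \<theta> * \<bar>d\<bar> / (t + 1)" unfolding z_def using th0 t0 by (simp add: abs_mult)
      also have "\<dots> \<le> 2 * \<theta> * t / (t + 1)" using d th0 t0 by (intro divide_right_mono mult_left_mono) auto
      also have "\<dots> \<le> 1"
      proof -
        have "2 * \<theta> * t \<le> 1 * t" using th0 t0 by (intro mult_right_mono) auto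
        then have "2 * \<theta> * t \<le> t + 1" by linarith
        then show ?thesis using t0 by (simp add: pos_divide_le_eq)
      qed
      finally show ?thesis .
    qed
    have "(1 + s) / 2 * tie_potential \<theta> \<gamma> (t + 1) (d + 1)
           + (1 - s) / 2 * tie_potential \<theta> \<gamma> (t + 1) (d - 1)
        = (t + 1) powr \<gamma> * (exp (- \<theta> * (d\<^sup>2 + 1) / (t + 1))
            * ((1 + s) / 2 * exp (- z) + (1 - s) / 2 * exp z))"
    proof -
      have "- \<theta> * (d + 1)\<^sup>2 / (t + 1) = - \<theta> * (d\<^sup>2 + 1) / (t + 1) + - z"
        "- \<theta> * (d - 1)\<^sup>2 / (t + 1) = - \<theta> * (d\<^sup>2 + 1) / (t + 1) + z"
        unfolding z_def add_divide_distrib[symmetric] minus_divide_left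
        by (simp_all add: power2_eq_square algebra_simps)
      then show ?thesis
        unfolding tie_potential_def by (simp only: exp_add) (simp add: algebra_simps)
    qed
    also have "\<dots> \<le> (t powr \<gamma> * exp (\<gamma> * 1 / t)) * (exp (- \<theta> * (d\<^sup>2 + 1) / (t + 1)) * exp (z\<^sup>2 - s * z))"
      using two_point_mgf_le[OF s1 zb] powr_add_le[of t 1 \<gamma>] t0 th0 s1
      by (intro mult_mono mult_left_mono) auto
    also have "\<dots> = t powr \<gamma> * exp (\<gamma> / t + - \<theta> * (d\<^sup>2 + 1) / (t + 1) + (z\<^sup>2 - s * z))"
      by (simp only: exp_add) (simp add: mult_ac)
    also have "\<dots> \<le> t powr \<gamma> * exp (- \<theta> * d\<^sup>2 / t + a)"
    proof -
      have "- \<theta> * (d\<^sup>2 + 1) / (t + 1) + \<theta> * d\<^sup>2 / t - s * z = - c - w"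
        unfolding c_def w_def z_def ds using t0
        by (simp add: divide_simps) (simp add: algebra_simps power2_eq_square)
      moreover have "z\<^sup>2 \<le> 8 * \<theta> * c"
      proof -
        have "z\<^sup>2 = 4 * \<theta> * c * (t / (t + 1))\<^sup>2"
          unfolding z_def c_def ds by (simp add: power2_eq_square)
        also have "\<dots> \<le> 4 * \<theta> * c * 1"
          using t0 th0 c0 by (intro mult_left_mono) (auto simp: power_le_one_iff)
        finally have "z\<^sup>2 \<le> 4 * (\<theta> * c)" by simp
        moreover have "\<theta> * c \<ge> 0" using th0 c0 by simp
        ultimately show ?thesis by simp
      qed
      ultimately have "\<gamma> / t + - \<theta> * (d\<^sup>2 + 1) / (t + 1) + (z\<^sup>2 - s * z) \<le> - \<theta> * d\<^sup>2 / t + a"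
        unfolding a_def by simp
      then show ?thesis by (intro mult_left_mono) auto
    qed
    also have "\<dots> = v * exp a" unfolding v_def tie_potential_def by (simp only: exp_add mult_ac)
    finally show ?thesis .
  qed
  have down: "(1 + s) / 2 * tie_potential \<theta> \<gamma> (t - 1) (d - 1)
           + (1 - s) / 2 * tie_potential \<theta> \<gamma> (t - 1) (d + 1) \<le> v * exp e"
  proof -
    \<comment> \<open>The sign is reversed because removing a ball of the first colour lowers d; the
      two-point bound then applies with the same s.\<close>
    define z where "z = - 2 * \<theta> * d / (t - 1)"
    have zb: "\<bar>z\<bar> \<le> 1"
    proof -
      have "\<bar>z\<bar> = 2 * \<theta> * \<bar>d\<bar> / (t - 1)" unfolding z_def using th0 t by (simp add: abs_mult)
      also have "\<dots> \<le> 2 * \<theta> * t / (t - 1)" using d th0 t by (intro divide_right_mono mult_left_mono) auto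
      also have "\<dots> \<le> 1"
      proof -
        have "2 * \<theta> * t \<le> 1 / 2 * t" using th0 t0 by (intro mult_right_mono) auto
        then have "2 * \<theta> * t \<le> t - 1" using t by linarith
        then show ?thesis using t by (simp add: pos_divide_le_eq)
      qed
      finally show ?thesis .
    qed
    have "(1 + s) / 2 * tie_potential \<theta> \<gamma> (t - 1) (d - 1)
           + (1 - s) / 2 * tie_potential \<theta> \<gamma> (t - 1) (d + 1)
        = (t - 1) powr \<gamma> * (exp (- \<theta> * (d\<^sup>2 + 1) / (t - 1))
            * ((1 + s) / 2 * exp (- z) + (1 - s) / 2 * exp z))"
    proof -
      have "- \<theta> * (d - 1)\<^sup>2 / (t - 1) = - \<theta> * (d\<^sup>2 + 1) / (t - 1) + - z"
        "- \<theta> * (d + 1)\<^sup>2 / (t - 1) = - \<theta> * (d\<^sup>2 + 1) / (t - 1) + z"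
        unfolding z_def add_divide_distrib[symmetric] minus_divide_left
        by (simp_all add: power2_eq_square algebra_simps)
      then show ?thesis
        unfolding tie_potential_def by (simp only: exp_add) (simp add: algebra_simps)
    qed
    also have "\<dots> \<le> (t powr \<gamma> * exp (\<gamma> * (-1) / t)) * (exp (- \<theta> * (d\<^sup>2 + 1) / (t - 1)) * exp (z\<^sup>2 - s * z))"
      using two_point_mgf_le[OF s1 zb] powr_add_le[of t "-1" \<gamma>] t th0 s1
      by (intro mult_mono mult_left_mono) auto
    also have "\<dots> = t powr \<gamma> * exp (- \<gamma> / t + - \<theta> * (d\<^sup>2 + 1) / (t - 1) + (z\<^sup>2 - s * z))"
      by (simp only: exp_add) (simp add: mult_ac)
    also have "\<dots> \<le> t powr \<gamma> * exp (- \<theta> * d\<^sup>2 / t + e)"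
    proof -
      have "- \<theta> * (d\<^sup>2 + 1) / (t - 1) + \<theta> * d\<^sup>2 / t - s * z = c - \<theta> * (1 - s\<^sup>2) / (t - 1)"
        unfolding c_def z_def ds using t
        by (simp add: divide_simps) (simp add: algebra_simps power2_eq_square)
      also have "\<dots> \<le> c - w"
        unfolding w_def using t th0 s2 by (intro diff_left_mono divide_left_mono) auto
      finally have 1: "- \<theta> * (d\<^sup>2 + 1) / (t - 1) + \<theta> * d\<^sup>2 / t - s * z \<le> c - w" .
      have "z\<^sup>2 \<le> 8 * \<theta> * c"
      proof -
        have "z\<^sup>2 = 4 * \<theta> * c * (t / (t - 1))\<^sup>2"
          unfolding z_def c_def ds by (simp add: power2_eq_square)
        also have "\<dots> \<le> 4 * \<theta> * c * 2"
        proof -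
          \<comment> \<open>t >= 4 makes the square at most 16 / 9. This is the origin of the 8 in
            \<open>a\<close> and \<open>e\<close>; adding a ball would need only 4.\<close>
          have "t / (t - 1) \<le> 4 / 3" using t by (simp add: field_simps)
          then have "(t / (t - 1))\<^sup>2 \<le> (4 / 3)\<^sup>2" using t by (intro power_mono) auto
          also have "\<dots> \<le> (2::real)" by (simp add: power2_eq_square)
          finally show ?thesis using th0 c0 by (intro mult_left_mono) auto
        qed
        finally show ?thesis by simp
      qed
      with 1 have "- \<gamma> / t + - \<theta> * (d\<^sup>2 + 1) / (t - 1) + (z\<^sup>2 - s * z) \<le> - \<theta> * d\<^sup>2 / t + e"
        unfolding e_def by simp
      then show ?thesis by (intro mult_left_mono) auto
    qed
    also have "\<dots> = v * exp e" unfolding v_def tie_potential_def by (simp only: exp_add mult_ac)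
    finally show ?thesis .
  qed
  have mix: "p * exp a + (1 - p) * exp e \<le> 1"
  proof -
    define r where "r = \<theta> / t"
    have r0: "r \<ge> 0" "r \<le> \<theta> / 4"
      unfolding r_def using t(1) th0 by (simp, intro divide_left_mono) auto
    have w0: "w \<ge> 0" unfolding w_def using th0 s2 t0 by simp
    have wr: "w \<le> r"
    proof -
      have "w \<le> \<theta> * 1 / t" unfolding w_def using th0 s2 t0 by (intro frac_le mult_left_mono) auto
      then show ?thesis by (simp add: r_def)
    qed
    have gr: "\<gamma> / t = r / 4" unfolding r_def th by simp
    have ct: "8 * \<theta> * c \<le> c" "8 * \<theta> * c \<ge> 0"
      using mult_right_mono[of "8 * \<theta>" 1 c] th0 c0 by auto
    have ab: "\<bar>a\<bar> \<le> 2 * c + 2 * r" "\<bar>e\<bar> \<le> 2 * c + 2 * r"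
      unfolding a_def e_def gr using ct wr w0 r0 by auto
    have sq: "(2 * c + 2 * r)\<^sup>2 \<le> 8 * \<theta> * c + 2 * \<theta> * r"
    proof -
      have "(2 * c + 2 * r)\<^sup>2 \<le> 8 * c\<^sup>2 + 8 * r\<^sup>2"
        using zero_le_power2[of "c - r"] by (simp add: power2_eq_square algebra_simps)
      moreover have "c\<^sup>2 \<le> \<theta> * c" "r\<^sup>2 \<le> \<theta> / 4 * r"
        unfolding power2_eq_square using c0 r0 by (intro mult_right_mono; simp)+
      ultimately show ?thesis by simp
    qed
    have a2: "a\<^sup>2 \<le> 8 * \<theta> * c + 2 * \<theta> * r" "e\<^sup>2 \<le> 8 * \<theta> * c + 2 * \<theta> * r"
      using power_mono[OF ab(1), of 2] power_mono[OF ab(2), of 2] sq by auto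
    have 1: "exp a \<le> 1 + a + (8 * \<theta> * c + 2 * \<theta> * r)" "exp e \<le> 1 + e + (8 * \<theta> * c + 2 * \<theta> * r)"
      using exp_le_quadratic[of a] exp_le_quadratic[of e] a2 ab c0 r0 th0 by linarith+
    have "p * exp a + (1 - p) * exp e \<le> p * (1 + a + (8 * \<theta> * c + 2 * \<theta> * r))
       + (1 - p) * (1 + e + (8 * \<theta> * c + 2 * \<theta> * r))"
      using 1 p m by (intro add_mono mult_left_mono) auto
    also have "\<dots> = 1 - m * c + 16 * \<theta> * c + 2 * \<theta> * r - w + m * r / 4"
      unfolding a_def e_def gr m by (simp add: field_simps)
    \<comment> \<open>The budget: \<theta> = m / 64 makes 16 * \<theta> * c equal to m * c / 4, and
      t >= 1 / m makes w at least r / 2 - m * c / 2. The costs m * c / 4 + m * c / 2 fit into m * c,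
      and the costs r / 32 + r / 4 fit into r / 2.\<close>
    also have "\<dots> \<le> 1"
    proof -
      have "w \<ge> r / 2 - m * c / 2"
      proof -
        have "w \<ge> \<theta> * (1 - s\<^sup>2) / (2 * t)" unfolding w_def
          using th0 s2 t by (intro divide_left_mono) auto
        moreover have "\<theta> * (1 - s\<^sup>2) / (2 * t) = r / 2 - c * (1 / t) / 2"
          unfolding r_def c_def using t0 by (simp add: field_simps)
        moreover have "c * (1 / t) \<le> c * m"
          using c0 m t t0 by (intro mult_left_mono) (auto simp: field_simps)
        ultimately show ?thesis by (simp add: mult.commute)
      qed
      moreover have "16 * \<theta> * c = m * c / 4" unfolding th by simp
      moreover have "2 * \<theta> * r \<le> 2 * (1/64) * r" "m * r \<le> 1 * r" "m * c \<ge> 0"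
        using th0 r0 m1 m(2) c0 mult_right_mono[of "64 * \<theta>" 1 r] mult_right_mono[of m 1 r] by auto
      ultimately show ?thesis using r0 by linarith
    qed
    finally show ?thesis .
  qed
  have eq: "(1 + s) / 2 * (p * u1 + (1 - p) * u2) + (1 - s) / 2 * (p * u3 + (1 - p) * u4)
      = p * ((1 + s) / 2 * u1 + (1 - s) / 2 * u3) + (1 - p) * ((1 + s) / 2 * u2 + (1 - s) / 2 * u4)"
    for u1 u2 u3 u4 :: real by (simp add: field_simps)
  have "v \<ge> 0" unfolding v_def tie_potential_def by simp
  with mix have "v * (p * exp a + (1 - p) * exp e) \<le> v" by (simp add: mult_left_le)
  moreover have "p * (v * exp a) + (1 - p) * (v * exp e) = v * (p * exp a + (1 - p) * exp e)"
    by (simp add: algebra_simps)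
  moreover have "p * ((1 + s) / 2 * tie_potential \<theta> \<gamma> (t + 1) (d + 1)
           + (1 - s) / 2 * tie_potential \<theta> \<gamma> (t + 1) (d - 1)) \<le> p * (v * exp a)"
    using up p m by (intro mult_left_mono) auto
  moreover have "(1 - p) * ((1 + s) / 2 * tie_potential \<theta> \<gamma> (t - 1) (d - 1)
           + (1 - s) / 2 * tie_potential \<theta> \<gamma> (t - 1) (d + 1)) \<le> (1 - p) * (v * exp e)"
    using down p m by (intro mult_left_mono) auto
  ultimately show ?thesis unfolding v_def[symmetric] s_def[symmetric] eq by linarith
qed

lemma summable_exp_neg_powr:
  fixes k g :: real
  assumes "k > 0" "g > 0"
  shows "summable (\<lambda>s. exp (- (k * (real s + 2) powr g)))"
proof (rule summable_comparison_test_bigo)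
  show "summable (\<lambda>s. norm (1 / real s ^ 2))"
    using inverse_power_summable[of 2, where 'a = real] by (simp add: inverse_eq_divide power_one_over)
  show "(\<lambda>s. exp (- (k * (real s + 2) powr g))) \<in> O(\<lambda>s. 1 / real s ^ 2)"
    using assms by real_asymp
qed

lemma ex_greatest_of_total:
  assumes "finite G" "G \<noteq> {}"
    and trans: "\<And>a b c. lt a b \<Longrightarrow> lt b c \<Longrightarrow> lt a c"
    and total: "\<And>a b. a \<in> G \<Longrightarrow> b \<in> G \<Longrightarrow> a \<noteq> b \<Longrightarrow> lt a b \<or> lt b a"
  shows "\<exists>g\<in>G. \<forall>e\<in>G. e \<noteq> g \<longrightarrow> lt e g"
  using assms(1,2) total
proof (induction G rule: finite_ne_induct)
  case (singleton a)
  then show ?case by simp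
next
  case (insert a G)
  then obtain g where g: "g \<in> G" "\<And>e. e \<in> G \<Longrightarrow> e \<noteq> g \<Longrightarrow> lt e g" by blast
  have "a \<noteq> g" using g insert by auto
  then consider "lt a g" | "lt g a" using insert.prems g by blast
  then show ?case
  proof cases
    case 1
    then show ?thesis using g by blast
  next
    case 2
    then have "lt e a" if "e \<in> G" for e using g(2)[OF that] trans that by blast
    then show ?thesis by blast
  qed
qed

section \<open>Cylinder sets of histories and the maximal inequality\<close>

text \<open>The weights add up to 1, so after subtracting the common value k only the colours in F
  contribute. F will be the one or two colours that a potential looks at.\<close>

lemma sum_count_weights:
  fixes A :: "'a multiset" and h :: "'a \<Rightarrow> real"
  assumes "A \<noteq> {#}" "finite F" and h: "\<And>e. e \<notin> F \<Longrightarrow> h e = k"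
  shows "(\<Sum>e\<in>set_mset A. real (count A e) / real (size A) * h e)
    = k + (\<Sum>e\<in>F. real (count A e) / real (size A) * (h e - k))"
proof -
  let ?w = "\<lambda>e. real (count A e) / real (size A)"
  have "(\<Sum>e\<in>set_mset A. ?w e) = real (\<Sum>e\<in>set_mset A. count A e) / real (size A)"
    by (simp only: sum_divide_distrib[symmetric] of_nat_sum[symmetric])
  also have "\<dots> = 1" using assms(1) by (simp flip: size_multiset_overloaded_eq)
  finally have w1: "(\<Sum>e\<in>set_mset A. ?w e) = 1" .
  have "(\<Sum>e\<in>set_mset A. ?w e * (h e - k)) = (\<Sum>e\<in>set_mset A \<union> F. ?w e * (h e - k))"
    using assms(2) by (intro sum.mono_neutral_left) (auto simp: not_in_iff)
  also have "\<dots> = (\<Sum>e\<in>F. ?w e * (h e - k))"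
    using assms(2) h by (intro sum.mono_neutral_right) auto
  finally have "(\<Sum>e\<in>set_mset A. ?w e * h e) - (\<Sum>e\<in>set_mset A. ?w e) * k
      = (\<Sum>e\<in>F. ?w e * (h e - k))"
    by (simp add: right_diff_distrib sum_subtractf sum_distrib_right)
  with w1 show ?thesis by simp
qed

context infinite_colour_urn begin

definition past :: "nat \<Rightarrow> (nat \<Rightarrow> 'c multiset) \<Rightarrow> 'c set" where
  "past n x = (\<Union>m\<le>n. set_mset (x m))"

text \<open>The atoms of the history up to time n. Values of x after n are ignored, so one function
  x can be updated as time goes on.\<close>

definition cyl :: "nat \<Rightarrow> (nat \<Rightarrow> 'c multiset) \<Rightarrow> 'w set" where
  "cyl n x = {w \<in> space M. \<forall>m\<le>n. U m w = x m}"

lemma pred_U: "Measurable.pred M (\<lambda>w. Q (U n w))"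
  using measurable_compose[OF measurable_U, of Q "count_space UNIV" n] by simp

lemma pred_past: "Measurable.pred M (\<lambda>w. d \<in> past n (\<lambda>m. U m w))"
  unfolding past_def UN_iff by (intro pred_intros_finite pred_U) auto

lemma sets_cyl [measurable]: "cyl n x \<in> sets M"
proof -
  have [measurable]: "Measurable.pred M (\<lambda>w. U m w = x m)" for m by (rule pred_U)
  show ?thesis unfolding cyl_def by measurable
qed

lemma cyl_Suc: "cyl (Suc n) x = {w \<in> cyl n x. U (Suc n) w = x (Suc n)}"
  unfolding cyl_def by (auto simp: le_Suc_eq)

lemma cyl_cong: "(\<And>m. m \<le> n \<Longrightarrow> x m = y m) \<Longrightarrow> cyl n x = cyl n y"
  unfolding cyl_def by auto

lemma past_cong: "(\<And>m. m \<le> n \<Longrightarrow> x m = y m) \<Longrightarrow> past n x = past n y"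
  unfolding past_def by auto

lemma past_cyl: "w \<in> cyl n x \<Longrightarrow> past n (\<lambda>m. U m w) = past n x"
  unfolding cyl_def by (intro past_cong) auto

lemma past_mono: "m \<le> n \<Longrightarrow> past m x \<subseteq> past n x"
  unfolding past_def by (auto intro: order.trans)

lemma countable_UNIV_mset: "countable (UNIV :: 'c multiset set)"
proof -
  have "(UNIV :: 'c multiset set) = range mset"
    using ex_mset by (metis surj_def)
  then show ?thesis by (metis countable_image countableI_type)
qed

text \<open>The functions x are uncountably many, but only their first n + 1 values matter. Indexing
  the cylinders by lists leaves a countable family.\<close>

lemma AE_cylI:
  assumes "\<And>x. AE w in M. w \<in> cyl n x \<longrightarrow> P w"
  shows "AE w in M. P w"
proof -
  have "countable (range (map mset :: 'c list list \<Rightarrow> 'c multiset list))" by simp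
  moreover have "range (map mset :: 'c list list \<Rightarrow> _) = UNIV"
  proof -
    have "\<exists>ys :: 'c list list. map mset ys = xs" for xs
      by (metis ex_map_conv ex_mset)
    then show ?thesis by (metis surj_def)
  qed
  ultimately have "countable (UNIV :: 'c multiset list set)" by simp
  then have "AE w in M. \<forall>l\<in>UNIV. w \<in> cyl n (\<lambda>m. l ! m) \<longrightarrow> P w"
    using assms by (subst AE_ball_countable) auto
  with AE_space show ?thesis
  proof eventually_elim
    case (elim w)
    have "w \<in> cyl n (\<lambda>m. map (\<lambda>m. U m w) [0..<Suc n] ! m)"
      using elim(1) unfolding cyl_def by (auto simp del: upt_Suc)
    then show ?case using elim(2) by blast
  qed
qed

text \<open>Total probability over the countably many next contents. The counting-measure integral
  avoids summability side conditions.\<close>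

lemma emeasure_cyl_split:
  assumes [measurable]: "B \<in> sets M"
  shows "emeasure M (cyl n x \<inter> B)
    = (\<integral>\<^sup>+A. emeasure M (cyl (Suc n) (x(Suc n := A)) \<inter> B) \<partial>count_space UNIV)"
proof -
  have eq: "cyl (Suc n) (x(Suc n := A)) = {w \<in> cyl n x. U (Suc n) w = A}" for A
    unfolding cyl_Suc using cyl_cong[of n "x(Suc n := A)" x] by simp
  have "cyl n x \<inter> B = (\<Union>A. cyl (Suc n) (x(Suc n := A)) \<inter> B)"
    unfolding eq by auto
  also have "emeasure M \<dots> = (\<integral>\<^sup>+A. emeasure M (cyl (Suc n) (x(Suc n := A)) \<inter> B) \<partial>count_space UNIV)"
    by (rule emeasure_UN_countable) (auto simp: disjoint_family_on_def countable_UNIV_mset, auto simp: eq)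
  finally show ?thesis .
qed

section \<open>The two kinds of transition out of a history\<close>

definition reinforced :: "nat \<Rightarrow> (nat \<Rightarrow> 'c multiset) \<Rightarrow> 'c \<Rightarrow> 'w set" where
  "reinforced n x c = {w \<in> cyl n x. U (Suc n) w = x n + {#c#}}"

definition recoloured :: "nat \<Rightarrow> (nat \<Rightarrow> 'c multiset) \<Rightarrow> 'c \<Rightarrow> 'w set" where
  "recoloured n x c = {w \<in> cyl n x. \<exists>d. d \<notin> past n x \<and> U (Suc n) w = x n - {#c#} + {#d#}}"

lemma sets_reinforced [measurable]: "reinforced n x c \<in> sets M"
proof -
  have "reinforced n x c = cyl n x \<inter> {w \<in> space M. U (Suc n) w = x n + {#c#}}"
    unfolding reinforced_def cyl_def by auto
  then show ?thesis using sets.Int[OF sets_cyl predE[OF pred_U[of "\<lambda>A. A = x n + {#c#}" "Suc n"]]] by simp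
qed

lemma sets_recoloured [measurable]: "recoloured n x c \<in> sets M"
proof -
  let ?Q = "\<lambda>A. \<exists>d. d \<notin> past n x \<and> A = x n - {#c#} + {#d#}"
  have "recoloured n x c = cyl n x \<inter> {w \<in> space M. ?Q (U (Suc n) w)}"
    unfolding recoloured_def cyl_def by auto
  then show ?thesis using sets.Int[OF sets_cyl predE[OF pred_U[of ?Q "Suc n"]]] by simp
qed

text \<open>In product form the transition rule also holds on null cylinders, about which the locale
  says nothing, so later arguments need no case distinction.\<close>

lemma prob_reinforced:
  assumes "c \<in># x n"
  shows "prob (reinforced n x c) = p * (real (count (x n) c) / real (size (x n))) * prob (cyl n x)"
proof (cases "prob (cyl n x) > 0")
  case True
  have "prob (reinforced n x c) / prob (cyl n x) = p * (real (count (x n) c) / real (size (x n)))"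
    using reinforce[of n x c] assms True unfolding cond_prob_def reinforced_def cyl_def
    by (simp add: conj_ac)
  then show ?thesis using True by (simp add: field_simps)
next
  case False
  then have "prob (cyl n x) = 0" by (simp add: zero_less_measure_iff)
  moreover have "prob (reinforced n x c) \<le> prob (cyl n x)"
    by (intro finite_measure_mono) (auto simp: reinforced_def)
  ultimately show ?thesis using measure_nonneg[of M "reinforced n x c"] by simp
qed

lemma prob_recoloured:
  assumes "c \<in># x n"
  shows "prob (recoloured n x c) = (1 - p) * (real (count (x n) c) / real (size (x n))) * prob (cyl n x)"
proof (cases "prob (cyl n x) > 0")
  case True
  have "prob (recoloured n x c) / prob (cyl n x) = (1 - p) * (real (count (x n) c) / real (size (x n)))"
    using recolour[of n x c] assms True unfolding cond_prob_def recoloured_def cyl_def past_def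
    by (simp add: conj_ac)
  then show ?thesis using True by (simp add: field_simps)
next
  case False
  then have "prob (cyl n x) = 0" by (simp add: zero_less_measure_iff)
  moreover have "prob (recoloured n x c) \<le> prob (cyl n x)"
    by (intro finite_measure_mono) (auto simp: recoloured_def)
  ultimately show ?thesis using measure_nonneg[of M "recoloured n x c"] by simp
qed

text \<open>The locale does not forbid other transitions outright. They are null because the listed
  events are disjoint and already exhaust the probability of the cylinder.\<close>

lemma AE_cyl_step:
  assumes ne: "x n \<noteq> {#}"
  shows "AE w in M. w \<in> cyl n x \<longrightarrow> w \<in> (\<Union>c\<in>set_mset (x n). reinforced n x c \<union> recoloured n x c)"
proof -
  let ?I = "set_mset (x n)" and ?E = "\<lambda>c. reinforced n x c \<union> recoloured n x c"
  have disj1: "reinforced n x c \<inter> recoloured n x c' = {}" if "c' \<in> ?I" for c c'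
  proof -
    \<comment> \<open>Reinforcement enlarges the urn, recolouring keeps its size.\<close>
    have "size (x n + {#c#}) \<noteq> size (x n - {#c'#} + {#d#})" for d
      using size_Diff_singleton[OF that] ne by (cases "size (x n)") auto
    then have "x n - {#c'#} + {#d#} \<noteq> x n + {#c#}" for d by metis
    then show ?thesis unfolding reinforced_def recoloured_def by auto
  qed
  have disj2: "recoloured n x c \<inter> recoloured n x c' = {}" if "c \<in> ?I" "c' \<in> ?I" "c \<noteq> c'" for c c'
  proof -
    \<comment> \<open>The count of c drops only on the right-hand side, where the new label d
      differs from c.\<close>
    have "x n - {#c'#} + {#d'#} \<noteq> x n - {#c#} + {#d#}" if "d \<notin> past n x" for d d'
    proof
      assume "x n - {#c'#} + {#d'#} = x n - {#c#} + {#d#}"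
      then have "count (x n - {#c#} + {#d#}) c = count (x n - {#c'#} + {#d'#}) c" by simp
      moreover have "d \<noteq> c" using that \<open>c \<in> ?I\<close> unfolding past_def by auto
      moreover obtain k where "count (x n) c = Suc k"
        using \<open>c \<in> ?I\<close> not0_implies_Suc[of "count (x n) c"] by auto
      ultimately show False using \<open>c \<noteq> c'\<close> by (auto split: if_splits)
    qed
    then show ?thesis unfolding recoloured_def by auto
  qed
  have disj3: "reinforced n x c \<inter> reinforced n x c' = {}" if "c \<noteq> c'" for c c'
    using that unfolding reinforced_def by auto
  have "prob (\<Union>c\<in>?I. ?E c) = (\<Sum>c\<in>?I. prob (?E c))"
  proof (intro finite_measure_finite_Union)
    show "disjoint_family_on ?E ?I"
      unfolding disjoint_family_on_def
    proof (intro ballI impI)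
      fix c c' assume "c \<in> ?I" "c' \<in> ?I" "c \<noteq> c'"
      then show "?E c \<inter> ?E c' = {}"
        using disj1[of c' c] disj1[of c c'] disj2[of c c'] disj3[of c c'] by blast
    qed
  qed auto
  also have "\<dots> = (\<Sum>c\<in>?I. real (count (x n) c) / real (size (x n)) * prob (cyl n x))"
  proof (intro sum.cong refl)
    fix c assume c: "c \<in> ?I"
    have "prob (?E c) = prob (reinforced n x c) + prob (recoloured n x c)"
      using disj1[OF c] by (intro finite_measure_Union) auto
    then show "prob (?E c) = real (count (x n) c) / real (size (x n)) * prob (cyl n x)"
      unfolding prob_reinforced[of c x n, OF c] prob_recoloured[of c x n, OF c]
      by (simp only: distrib_right[symmetric]) simp
  qed
  also have "\<dots> = real (\<Sum>c\<in>?I. count (x n) c) / real (size (x n)) * prob (cyl n x)"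
    by (simp only: sum_distrib_right[symmetric] sum_divide_distrib[symmetric] of_nat_sum[symmetric])
  also have "\<dots> = prob (cyl n x)"
    using ne by (simp flip: size_multiset_overloaded_eq)
  finally have "prob (\<Union>c\<in>?I. ?E c) = prob (cyl n x)" .
  moreover have "(\<Union>c\<in>?I. ?E c) \<subseteq> cyl n x"
    by (auto simp: reinforced_def recoloured_def)
  moreover have E: "(\<Union>c\<in>?I. ?E c) \<in> sets M"
    by (intro sets.finite_UN sets.Un sets_reinforced sets_recoloured) auto
  ultimately have "prob (cyl n x - (\<Union>c\<in>?I. ?E c)) = 0"
    using finite_measure_Diff[OF sets_cyl E] by simp
  then have "cyl n x - (\<Union>c\<in>?I. ?E c) \<in> null_sets M"
    using E by (auto simp: null_sets_def emeasure_eq_measure simp del: UN_Un UN_simps)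
  then have "AE w in M. w \<notin> cyl n x - (\<Union>c\<in>?I. ?E c)" by (rule AE_not_in)
  then show ?thesis by eventually_elim auto
qed

section \<open>The rules as a property of single paths\<close>

definition valid_step :: "nat \<Rightarrow> (nat \<Rightarrow> 'c multiset) \<Rightarrow> bool" where
  "valid_step n x \<longleftrightarrow> (\<exists>c\<in>#x n. x (Suc n) = x n + {#c#}
     \<or> (\<exists>d. d \<notin> past n x \<and> x (Suc n) = x n - {#c#} + {#d#}))"

lemma AE_valid_step: "AE w in M. U n w \<noteq> {#} \<longrightarrow> valid_step n (\<lambda>m. U m w)"
proof (rule AE_cylI[of n])
  fix x
  show "AE w in M. w \<in> cyl n x \<longrightarrow> U n w \<noteq> {#} \<longrightarrow> valid_step n (\<lambda>m. U m w)"
  proof (cases "x n = {#}")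
    case True
    then show ?thesis by (auto simp: cyl_def)
  next
    case False
    from AE_cyl_step[of x n, OF this] show ?thesis
    proof eventually_elim
      case (elim w)
      have "w \<in> cyl n x \<Longrightarrow> U n w = x n" by (auto simp: cyl_def)
      with elim show ?case
        unfolding valid_step_def reinforced_def recoloured_def using past_cyl[of w n x] by auto
    qed
  qed
qed

lemma AE_size: "AE w in M. U n w \<noteq> {#} \<and> size (U n w) \<le> Suc n"
proof (induction n)
  case 0
  from start show ?case by eventually_elim auto
next
  case (Suc n)
  from Suc AE_valid_step[of n] show ?case
  proof eventually_elim
    case (elim w)
    then obtain c where "c \<in># U n w" "U (Suc n) w = U n w + {#c#}
       \<or> (\<exists>d. U (Suc n) w = U n w - {#c#} + {#d#})"
      unfolding valid_step_def by blast
    then show ?case using elim size_Diff1_le[of "U n w" c] by auto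
  qed
qed

text \<open>An almost sure property that depends only on the history holds outright on a cylinder of
  positive probability.\<close>

lemma cyl_size:
  assumes "prob (cyl n x) > 0"
  shows "x n \<noteq> {#}" "size (x n) \<le> Suc n"
proof -
  have "\<not> (AE w in M. w \<notin> cyl n x)"
    using assms AE_iff_null_sets[OF sets_cyl, of n x]
    by (auto simp: null_sets_def emeasure_eq_measure)
  moreover have "AE w in M. w \<notin> cyl n x" if "\<not> (x n \<noteq> {#} \<and> size (x n) \<le> Suc n)"
    using AE_size[of n]
  proof eventually_elim
    case (elim w)
    then show ?case using that by (auto simp: cyl_def)
  qed
  ultimately show "x n \<noteq> {#}" "size (x n) \<le> Suc n" by blast+
qed

text \<open>
  The conditional expectation of $V$ after one step. A recolouring only removes a ball here, because
  it is used for $V$ that ignore the balls of brand new colours.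
\<close>

definition drift_sum :: "('c multiset \<Rightarrow> real) \<Rightarrow> 'c multiset \<Rightarrow> real" where
  "drift_sum V A = (\<Sum>c\<in>set_mset A. real (count A c) / real (size A)
     * (p * V (A + {#c#}) + (1 - p) * V (A - {#c#})))"

text \<open>\<open>C\<close> contains the colours that V looks at. They all lie in the past, so V
  cannot see the label created by a recolouring; this removes the freedom in its choice. The left
  side is the expectation of V after the step, restricted to the cylinder.\<close>

lemma one_step_le:
  assumes p: "0 \<le> p" "p \<le> 1" and ne: "x n \<noteq> {#}"
    and V: "\<And>A. V A \<ge> 0" and VC: "\<And>A d. d \<notin> C \<Longrightarrow> V (A + {#d#}) = V A"
    and C: "C \<subseteq> past n x"
  shows "(\<integral>\<^sup>+A. ennreal (V A) * emeasure M (cyl (Suc n) (x(Suc n := A))) \<partial>count_space UNIV)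
      \<le> ennreal (drift_sum V (x n)) * emeasure M (cyl n x)"
proof -
  let ?I = "set_mset (x n)" and ?c = "\<lambda>A. cyl (Suc n) (x(Suc n := A))"
  let ?R = "reinforced n x" and ?N = "recoloured n x"
  have cU: "U (Suc n) w = A" "w \<in> cyl n x" if "w \<in> ?c A" for w A
    using that unfolding cyl_def by (auto simp: le_Suc_eq)
  have "(\<integral>\<^sup>+A. ennreal (V A) * emeasure M (?c A) \<partial>count_space UNIV)
    \<le> (\<integral>\<^sup>+A. (\<Sum>c\<in>?I. ennreal (V (x n + {#c#})) * emeasure M (?c A \<inter> ?R c)
           + ennreal (V (x n - {#c#})) * emeasure M (?c A \<inter> ?N c)) \<partial>count_space UNIV)"
  proof (intro nn_integral_mono)
    fix A
    have "emeasure M (?c A) \<le> emeasure M (\<Union>c\<in>?I. (?c A \<inter> ?R c) \<union> (?c A \<inter> ?N c))"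
    proof (rule emeasure_mono_AE)
      show "AE w in M. w \<in> ?c A \<longrightarrow> w \<in> (\<Union>c\<in>?I. (?c A \<inter> ?R c) \<union> (?c A \<inter> ?N c))"
        using AE_cyl_step[of x n, OF ne]
      proof eventually_elim
        case (elim w)
        then show ?case using cU(2)[of w A] by auto
      qed
    qed auto
    also have "\<dots> \<le> (\<Sum>c\<in>?I. emeasure M ((?c A \<inter> ?R c) \<union> (?c A \<inter> ?N c)))"
      by (intro emeasure_subadditive_finite) auto
    also have "\<dots> \<le> (\<Sum>c\<in>?I. emeasure M (?c A \<inter> ?R c) + emeasure M (?c A \<inter> ?N c))"
      by (intro sum_mono emeasure_subadditive) auto
    finally have "ennreal (V A) * emeasure M (?c A)
      \<le> (\<Sum>c\<in>?I. ennreal (V A) * emeasure M (?c A \<inter> ?R c) + ennreal (V A) * emeasure M (?c A \<inter> ?N c))"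
      by (simp add: mult_left_mono sum_distrib_left[symmetric] distrib_left[symmetric])
    \<comment> \<open>On a nonempty piece the value V A is determined by c alone. With a factor free
      of A, the integral over A reassembles \<open>?R c\<close> and \<open>?N c\<close>.\<close>
    also have "\<dots> = (\<Sum>c\<in>?I. ennreal (V (x n + {#c#})) * emeasure M (?c A \<inter> ?R c)
           + ennreal (V (x n - {#c#})) * emeasure M (?c A \<inter> ?N c))"
    proof (intro sum.cong refl arg_cong2[of _ _ _ _ "(+)"])
      fix c assume "c \<in> ?I"
      show "ennreal (V A) * emeasure M (?c A \<inter> ?R c) = ennreal (V (x n + {#c#})) * emeasure M (?c A \<inter> ?R c)"
      proof (cases "?c A \<inter> ?R c = {}")
        case False
        then have "A = x n + {#c#}" using cU(1) unfolding reinforced_def by fastforce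
        then show ?thesis by simp
      qed simp
      show "ennreal (V A) * emeasure M (?c A \<inter> ?N c) = ennreal (V (x n - {#c#})) * emeasure M (?c A \<inter> ?N c)"
      proof (cases "?c A \<inter> ?N c = {}")
        case False
        then obtain d where "d \<notin> past n x" "A = x n - {#c#} + {#d#}"
          using cU(1) unfolding recoloured_def by fastforce
        then have "V A = V (x n - {#c#})" using VC C by auto
        then show ?thesis by simp
      qed simp
    qed
    finally show "ennreal (V A) * emeasure M (?c A) \<le> \<dots>" .
  qed
  also have "\<dots> = (\<Sum>c\<in>?I. ennreal (V (x n + {#c#})) * emeasure M (?R c)
           + ennreal (V (x n - {#c#})) * emeasure M (?N c))"
  proof -
    have "cyl n x \<inter> ?R c = ?R c" "cyl n x \<inter> ?N c = ?N c" for c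
      unfolding reinforced_def recoloured_def by auto
    then have "(\<integral>\<^sup>+A. emeasure M (?c A \<inter> ?R c) \<partial>count_space UNIV) = emeasure M (?R c)"
      "(\<integral>\<^sup>+A. emeasure M (?c A \<inter> ?N c) \<partial>count_space UNIV) = emeasure M (?N c)" for c
      using emeasure_cyl_split[of "?R c" n x] emeasure_cyl_split[of "?N c" n x] by auto
    then show ?thesis by (simp add: nn_integral_sum nn_integral_add nn_integral_cmult)
  qed
  also have "\<dots> = ennreal (\<Sum>c\<in>?I. V (x n + {#c#}) * prob (?R c) + V (x n - {#c#}) * prob (?N c))"
    using V by (simp add: emeasure_eq_measure ennreal_mult'[symmetric] ennreal_plus[symmetric] sum_ennreal del: ennreal_plus)
  also have "(\<Sum>c\<in>?I. V (x n + {#c#}) * prob (?R c) + V (x n - {#c#}) * prob (?N c))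
      = drift_sum V (x n) * prob (cyl n x)"
    unfolding drift_sum_def sum_distrib_right
  proof (intro sum.cong refl)
    fix c assume c: "c \<in> ?I"
    have "a * (p * r * P) + b * ((1 - p) * r * P) = r * (p * a + (1 - p) * b) * P" for a b r P :: real
      by (simp add: algebra_simps)
    then show "V (x n + {#c#}) * prob (?R c) + V (x n - {#c#}) * prob (?N c)
      = real (count (x n) c) / real (size (x n)) * (p * V (x n + {#c#}) + (1 - p) * V (x n - {#c#}))
        * prob (cyl n x)"
      unfolding prob_reinforced[of c x n, OF c] prob_recoloured[of c x n, OF c] .
  qed
  also have "ennreal \<dots> = ennreal (drift_sum V (x n)) * emeasure M (cyl n x)"
    unfolding emeasure_eq_measure using V p
    by (intro ennreal_mult) (auto simp: drift_sum_def intro!: sum_nonneg)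
  finally show ?thesis .
qed

text \<open>
  The event $B$ allows two uses: to restrict to paths with a given property, and to multiply
  a stopping bound with a bound on what happens after the stopping time.
\<close>

lemma maximal_inequality_horizon:
  assumes p: "0 \<le> p" "p \<le> 1"
    and V: "\<And>n A. V n A \<ge> 0" and VC: "\<And>n A d. d \<notin> C \<Longrightarrow> V n (A + {#d#}) = V n A"
    and step: "\<And>n A. n \<ge> n0 \<Longrightarrow> A \<noteq> {#} \<Longrightarrow> size A \<le> Suc n \<Longrightarrow> A \<notin> D n
      \<Longrightarrow> drift_sum (V (Suc n)) A \<le> V n A"
    and B [measurable]: "B \<in> sets M"
    and stop: "\<And>n x. n \<ge> n0 \<Longrightarrow> C \<subseteq> past n x \<Longrightarrow> x n \<in> D n
      \<Longrightarrow> prob (cyl n x \<inter> B) \<le> V n (x n) * prob (cyl n x)"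
    and "n \<ge> n0" "C \<subseteq> past n x"
  shows "emeasure M (cyl n x \<inter> {w \<in> space M. w \<in> B \<and> (\<exists>k\<in>{n..n + N}. U k w \<in> D k)})
    \<le> ennreal (V n (x n)) * emeasure M (cyl n x)"
  using \<open>n \<ge> n0\<close> \<open>C \<subseteq> past n x\<close>
proof (induction N arbitrary: n x)
  case (0 n x)
  show ?case
  proof (cases "x n \<in> D n")
    case True
    have "emeasure M (cyl n x \<inter> {w \<in> space M. w \<in> B \<and> (\<exists>k\<in>{n..n + 0}. U k w \<in> D k)})
      \<le> emeasure M (cyl n x \<inter> B)" by (intro emeasure_mono) auto
    also have "\<dots> \<le> ennreal (V n (x n) * prob (cyl n x))"
      using stop[OF 0 True] by (simp add: emeasure_eq_measure ennreal_leI)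
    finally show ?thesis using V by (simp add: emeasure_eq_measure ennreal_mult)
  next
    case False
    then have "cyl n x \<inter> {w \<in> space M. w \<in> B \<and> (\<exists>k\<in>{n..n + 0}. U k w \<in> D k)} = {}"
      by (auto simp: cyl_def)
    then show ?thesis by simp
  qed
next
  case (Suc N n x)
  have [measurable]: "Measurable.pred M (\<lambda>w. U k w \<in> D k)" for k by (rule pred_U)
  consider "prob (cyl n x) = 0" | "x n \<in> D n" | "prob (cyl n x) > 0" "x n \<notin> D n"
    using measure_nonneg[of M "cyl n x"] by linarith
  then show ?case
  proof cases
    case 1
    have "emeasure M (cyl n x \<inter> {w \<in> space M. w \<in> B \<and> (\<exists>k\<in>{n..n + Suc N}. U k w \<in> D k)})
      \<le> emeasure M (cyl n x)" by (intro emeasure_mono) auto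
    then show ?thesis using 1 by (simp add: emeasure_eq_measure)
  next
    case 2
    have "emeasure M (cyl n x \<inter> {w \<in> space M. w \<in> B \<and> (\<exists>k\<in>{n..n + Suc N}. U k w \<in> D k)})
      \<le> emeasure M (cyl n x \<inter> B)" by (intro emeasure_mono) auto
    also have "\<dots> \<le> ennreal (V n (x n) * prob (cyl n x))"
      using stop[OF Suc.prems 2] by (simp add: emeasure_eq_measure ennreal_leI)
    finally show ?thesis using V by (simp add: emeasure_eq_measure ennreal_mult)
  next
    case 3
    \<comment> \<open>Not stopped yet, so the visit happens after n. The induction hypothesis bounds
      it on every one-step extension, and the drift condition brings the average of these bounds
      back to time n.\<close>
    note sz = cyl_size[OF 3(1)]
    let ?x = "\<lambda>A. x(Suc n := A)"
    have "cyl n x \<inter> {w \<in> space M. w \<in> B \<and> (\<exists>k\<in>{n..n + Suc N}. U k w \<in> D k)}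
      \<subseteq> cyl n x \<inter> {w \<in> space M. w \<in> B \<and> (\<exists>k\<in>{Suc n..Suc n + N}. U k w \<in> D k)}"
    proof safe
      fix w k assume "w \<in> cyl n x" "k \<in> {n..n + Suc N}" "U k w \<in> D k"
      then have "k \<noteq> n" using 3(2) by (auto simp: cyl_def)
      then show "\<exists>k\<in>{Suc n..Suc n + N}. U k w \<in> D k"
        using \<open>k \<in> {n..n + Suc N}\<close> \<open>U k w \<in> D k\<close> by (intro bexI[of _ k]) auto
    qed
    then have "emeasure M (cyl n x \<inter> {w \<in> space M. w \<in> B \<and> (\<exists>k\<in>{n..n + Suc N}. U k w \<in> D k)})
      \<le> emeasure M (cyl n x \<inter> {w \<in> space M. w \<in> B \<and> (\<exists>k\<in>{Suc n..Suc n + N}. U k w \<in> D k)})"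
      by (intro emeasure_mono) auto
    also have "\<dots> = (\<integral>\<^sup>+A. emeasure M (cyl (Suc n) (?x A)
      \<inter> {w \<in> space M. w \<in> B \<and> (\<exists>k\<in>{Suc n..Suc n + N}. U k w \<in> D k)}) \<partial>count_space UNIV)"
      by (rule emeasure_cyl_split) measurable
    also have "\<dots> \<le> (\<integral>\<^sup>+A. ennreal (V (Suc n) A) * emeasure M (cyl (Suc n) (?x A)) \<partial>count_space UNIV)"
    proof (intro nn_integral_mono)
      fix A
      have "past n x = past n (?x A)" by (intro past_cong) auto
      then have "C \<subseteq> past (Suc n) (?x A)" using Suc.prems(2) past_mono[of n "Suc n" "?x A"] by auto
      then show "emeasure M (cyl (Suc n) (?x A)
          \<inter> {w \<in> space M. w \<in> B \<and> (\<exists>k\<in>{Suc n..Suc n + N}. U k w \<in> D k)})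
        \<le> ennreal (V (Suc n) A) * emeasure M (cyl (Suc n) (?x A))"
        using Suc.IH[of "Suc n" "?x A"] Suc.prems(1) by (simp add: fun_upd_def)
    qed
    also have "\<dots> \<le> ennreal (drift_sum (V (Suc n)) (x n)) * emeasure M (cyl n x)"
      using V VC Suc.prems(2) by (intro one_step_le[where x = x and n = n, OF p sz(1)]) auto
    also have "\<dots> \<le> ennreal (V n (x n)) * emeasure M (cyl n x)"
      using step[OF Suc.prems(1) sz 3(2)] by (intro mult_right_mono ennreal_leI) auto
    finally show ?thesis .
  qed
qed

text \<open>Ville's inequality on a cylinder. The horizon events increase with N and their bound
  does not depend on N.\<close>

lemma maximal_inequality:
  assumes p: "0 \<le> p" "p \<le> 1"
    and V: "\<And>n A. V n A \<ge> 0" and VC: "\<And>n A d. d \<notin> C \<Longrightarrow> V n (A + {#d#}) = V n A"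
    and step: "\<And>n A. n \<ge> n0 \<Longrightarrow> A \<noteq> {#} \<Longrightarrow> size A \<le> Suc n \<Longrightarrow> A \<notin> D n
      \<Longrightarrow> drift_sum (V (Suc n)) A \<le> V n A"
    and B [measurable]: "B \<in> sets M"
    and stop: "\<And>n x. n \<ge> n0 \<Longrightarrow> C \<subseteq> past n x \<Longrightarrow> x n \<in> D n
      \<Longrightarrow> prob (cyl n x \<inter> B) \<le> V n (x n) * prob (cyl n x)"
    and n: "n \<ge> n0" "C \<subseteq> past n x"
  shows "prob (cyl n x \<inter> {w \<in> space M. w \<in> B \<and> (\<exists>k\<ge>n. U k w \<in> D k)}) \<le> V n (x n) * prob (cyl n x)"
proof -
  define H where "H N = cyl n x \<inter> {w \<in> space M. w \<in> B \<and> (\<exists>k\<in>{n..n + N}. U k w \<in> D k)}" for N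
  have [measurable]: "Measurable.pred M (\<lambda>w. U k w \<in> D k)" for k by (rule pred_U)
  have H [measurable]: "H N \<in> sets M" for N
    unfolding H_def by measurable
  have "(\<lambda>N. prob (H N)) \<longlonglongrightarrow> prob (\<Union>N. H N)"
    by (intro finite_Lim_measure_incseq) (auto simp: incseq_def H_def)
  moreover have "prob (H N) \<le> V n (x n) * prob (cyl n x)" for N
    using maximal_inequality_horizon[of V C n0 D B n x N, OF p V VC step B stop n] V
    unfolding H_def[symmetric] emeasure_eq_measure
    by (simp flip: ennreal_mult')
  moreover have "(\<Union>N. H N) = cyl n x \<inter> {w \<in> space M. w \<in> B \<and> (\<exists>k\<ge>n. U k w \<in> D k)}"
  proof -
    have "(\<exists>N. \<exists>k\<in>{n..n + N}. P k) \<longleftrightarrow> (\<exists>k\<ge>n. P k)" for P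
    proof safe
      fix k assume "n \<le> k" "P k"
      then show "\<exists>N. \<exists>k\<in>{n..n + N}. P k"
        by (intro exI[of _ "k - n"] bexI[of _ k]) auto
    qed auto
    then show ?thesis unfolding H_def by auto
  qed
  ultimately show ?thesis by (auto intro: LIMSEQ_le_const2)
qed

text \<open>Draws of other colours leave g unchanged. The truncated subtraction at count 0 is
  harmless because its weight is 0.\<close>

lemma drift_sum_count:
  assumes "A \<noteq> {#}"
  shows "drift_sum (\<lambda>A. g (count A c)) A = g (count A c)
    + real (count A c) / real (size A)
      * (p * g (count A c + 1) + (1 - p) * g (count A c - 1) - g (count A c))"
  unfolding drift_sum_def
  by (subst sum_count_weights[OF assms, of "{c}" _ "g (count A c)"]) (auto simp: algebra_simps)

lemma drift_sum_count2:
  assumes "A \<noteq> {#}" "a \<noteq> b"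
  shows "drift_sum (\<lambda>A. g (count A a) (count A b)) A = g (count A a) (count A b)
    + (real (count A a) * (p * g (count A a + 1) (count A b) + (1 - p) * g (count A a - 1) (count A b)
          - g (count A a) (count A b))
     + real (count A b) * (p * g (count A a) (count A b + 1) + (1 - p) * g (count A a) (count A b - 1)
          - g (count A a) (count A b))) / real (size A)"
  unfolding drift_sum_def
  using assms(2)
  by (subst sum_count_weights[OF assms(1), of "{a, b}" _ "g (count A a) (count A b)"])
     (auto simp: algebra_simps add_divide_distrib diff_divide_distrib)

lemma AE_cyl_notin:
  assumes [measurable]: "B \<in> sets M" and "prob (cyl n x \<inter> B) = 0"
  shows "AE w in M. w \<in> cyl n x \<longrightarrow> w \<notin> B"
proof -
  have "cyl n x \<inter> B \<in> null_sets M" using assms by (auto simp: null_sets_def emeasure_eq_measure)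
  then have "AE w in M. w \<notin> cyl n x \<inter> B" by (rule AE_not_in)
  then show ?thesis by eventually_elim auto
qed

text \<open>The bound is carried back from time n to time 0 by total probability and then summed
  over the initial contents.\<close>

lemma prob_le_cylI:
  assumes [measurable]: "B \<in> sets M" and "K \<ge> 0"
    and le: "\<And>x. prob (cyl n x \<inter> B) \<le> K * prob (cyl n x)"
  shows "prob B \<le> K"
proof -
  have "emeasure M (cyl m x \<inter> B) \<le> ennreal K * emeasure M (cyl m x)" if "m \<le> n" for m x
    using that
  proof (induction "n - m" arbitrary: m x)
    case 0
    then have "m = n" by simp
    then show ?case using le[of x] \<open>K \<ge> 0\<close>
      by (simp add: emeasure_eq_measure ennreal_mult'[symmetric] ennreal_leI)
  next
    case (Suc k m x)
    have "emeasure M (cyl m x \<inter> B) = (\<integral>\<^sup>+A. emeasure M (cyl (Suc m) (x(Suc m := A)) \<inter> B) \<partial>count_space UNIV)"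
      by (rule emeasure_cyl_split) fact
    also have "\<dots> \<le> (\<integral>\<^sup>+A. ennreal K * emeasure M (cyl (Suc m) (x(Suc m := A)) \<inter> space M) \<partial>count_space UNIV)"
      using Suc by (intro nn_integral_mono) (auto simp: sets.Int_space_eq2)
    also have "\<dots> = ennreal K * emeasure M (cyl m x \<inter> space M)"
      using emeasure_cyl_split[of "space M" m x] by (simp add: nn_integral_cmult)
    finally show ?case by (simp add: sets.Int_space_eq2)
  qed
  from this[of 0] have le0: "emeasure M (cyl 0 x \<inter> B) \<le> ennreal K * emeasure M (cyl 0 x)" for x by simp
  have split: "emeasure M B' = (\<integral>\<^sup>+A. emeasure M (cyl 0 (\<lambda>_. A) \<inter> B') \<partial>count_space UNIV)" if [measurable]: "B' \<in> sets M" for B'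
  proof -
    have "B' = (\<Union>A. cyl 0 (\<lambda>_. A) \<inter> B')"
      using sets.sets_into_space[OF that] by (auto simp: cyl_def)
    then have "emeasure M B' = emeasure M (\<Union>A. cyl 0 (\<lambda>_. A) \<inter> B')" by simp
    also have "\<dots> = (\<integral>\<^sup>+A. emeasure M (cyl 0 (\<lambda>_. A) \<inter> B') \<partial>count_space UNIV)"
      by (rule emeasure_UN_countable) (auto simp: disjoint_family_on_def countable_UNIV_mset, auto simp: cyl_def)
    finally show ?thesis .
  qed
  have "emeasure M B \<le> (\<integral>\<^sup>+A. ennreal K * emeasure M (cyl 0 (\<lambda>_. A) \<inter> space M) \<partial>count_space UNIV)"
    unfolding split[OF assms(1)] using le0 by (intro nn_integral_mono) (simp add: sets.Int_space_eq2)
  also have "\<dots> = ennreal K * emeasure M (space M)"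
    unfolding split[OF sets.top] by (simp add: nn_integral_cmult)
  finally show ?thesis using \<open>K \<ge> 0\<close> by (simp add: emeasure_eq_measure prob_space)
qed

lemma AE_valid_path: "AE w in M. \<forall>n. valid_step n (\<lambda>m. U m w)"
  unfolding AE_all_countable
proof
  fix n show "AE w in M. valid_step n (\<lambda>m. U m w)"
    using AE_size[of n] AE_valid_step[of n] by eventually_elim auto
qed

lemma valid_step_cong:
  assumes "\<And>m. m \<le> Suc n \<Longrightarrow> x m = y m"
  shows "valid_step n x = valid_step n y"
  using assms past_cong[of n x y] unfolding valid_step_def by simp

lemma cyl_valid_step:
  assumes "prob (cyl (Suc n) x) > 0"
  shows "valid_step n x"
proof (rule ccontr)
  assume neg: "\<not> valid_step n x"
  have "AE w in M. w \<notin> cyl (Suc n) x"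
    using AE_valid_path
  proof eventually_elim
    case (elim w)
    show ?case
    proof
      assume "w \<in> cyl (Suc n) x"
      then have "valid_step n (\<lambda>m. U m w) = valid_step n x"
        by (intro valid_step_cong) (auto simp: cyl_def)
      with elim neg show False by simp
    qed
  qed
  then show False
    using assms AE_iff_null_sets[OF sets_cyl, of "Suc n" x]
    by (auto simp: null_sets_def emeasure_eq_measure)
qed

text \<open>Discrete intermediate value argument: a brand new colour is neither a nor b, so one step
  moves the difference of their counts by at most one and the order cannot flip without a
  tie.\<close>

lemma count_order_preserved:
  assumes valid: "\<And>n. valid_step n x"
    and old: "a \<in> past n x" "b \<in> past n x"
    and neq: "\<And>k. k \<ge> n \<Longrightarrow> count (x k) a \<noteq> count (x k) b"
    and less: "count (x n) b < count (x n) a" and k: "k \<ge> n"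
  shows "count (x k) b < count (x k) a"
  using k
proof (induction k rule: dec_induct)
  case base
  then show ?case by (rule less)
next
  case (step k)
  have old': "a \<in> past k x" "b \<in> past k x" using old past_mono[OF step(1)] by auto
  have "count (x (Suc k)) b \<le> count (x (Suc k)) a"
  proof -
    obtain c where "c \<in># x k" and "x (Suc k) = x k + {#c#}
       \<or> (\<exists>d. d \<notin> past k x \<and> x (Suc k) = x k - {#c#} + {#d#})"
      using valid[of k] unfolding valid_step_def by blast
    from this(2) show ?thesis
    proof (elim disjE exE conjE)
      assume "x (Suc k) = x k + {#c#}"
      then show ?thesis using step.IH by auto
    next
      fix d assume "d \<notin> past k x" "x (Suc k) = x k - {#c#} + {#d#}"
      then show ?thesis using step.IH old' by auto
    qed
  qed
  moreover have "count (x (Suc k)) a \<noteq> count (x (Suc k)) b" using neq step(1) by simp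
  ultimately show ?case by simp
qed

end

section \<open>Survival and growth of a colour\<close>

locale supercritical_urn = infinite_colour_urn M p U
  for M :: "'w measure" and p :: real and U :: "nat \<Rightarrow> 'w \<Rightarrow> 'c::countable multiset" +
  assumes p_gt: "1 / 2 < p" and p_lt: "p < 1"
begin

text \<open>\<open>drift\<close>, \<open>offset\<close> and \<open>growth\<close> are the mu, b and
  \<beta> of the overview; \<open>growth\<close> is the rate delivered by
  \<open>recip_shift_drift\<close>.\<close>

definition drift :: real where "drift = 2 * p - 1"

definition offset :: real where "offset = 2 / drift"

definition growth :: real where "growth = drift / (2 * (1 + offset))"

lemma drift_pos: "drift > 0" and offset_pos: "offset > 0" and growth_pos: "growth > 0"
  and p01: "0 \<le> p" "p \<le> 1"
proof -
  show 1: "drift > 0" using p_gt by (simp add: drift_def)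
  then show 2: "offset > 0" by (simp add: offset_def)
  show "growth > 0" using 1 2 by (simp add: growth_def)
  show "0 \<le> p" "p \<le> 1" using p_gt p_lt by auto
qed

text \<open>\<open>recip_shift_drift\<close> is divided by the size of the urn. Since that is at
  most n + 1, each step loses at least the fraction \<open>growth / (n + 1)\<close>. K leaves room
  for a factor that depends on time.\<close>

lemma drift_sum_recip_le:
  assumes "c \<in># A" "size A \<le> Suc n" "K \<ge> 0"
  shows "drift_sum (\<lambda>A. K / (real (count A c) + offset)) A
    \<le> K / (real (count A c) + offset) * (1 - growth / (real n + 1))"
proof -
  define x where "x = count A c"
  define S where "S = real (size A)"
  have x: "x \<ge> 1" using assms(1) unfolding x_def by (simp add: Suc_le_eq)
  have A: "A \<noteq> {#}" using assms(1) by auto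
  have S: "S > 0" "S \<le> real n + 1" unfolding S_def using A assms(2) by (auto simp: nonempty_has_size)
  have "real x * (p / (real x + 1 + offset) + (1 - p) / (real x - 1 + offset) - 1 / (real x + offset))
      \<le> - growth / (real x + offset)"
    using recip_shift_drift[OF p_lt drift_def drift_pos, of "real x" offset] x
    unfolding growth_def offset_def by simp
  then have "K / S * (real x * (p / (real x + 1 + offset) + (1 - p) / (real x - 1 + offset) - 1 / (real x + offset)))
      \<le> K / S * (- growth / (real x + offset))"
    using S assms(3) by (intro mult_left_mono) auto
  also have "\<dots> = - (K / (real x + offset)) * (growth / S)" by simp
  also have "\<dots> \<le> - (K / (real x + offset)) * (growth / (real n + 1))"
    using S growth_pos offset_pos assms(3) by (intro mult_left_mono_neg divide_left_mono) auto
  finally have *: "K / S * (real x * (p / (real x + 1 + offset) + (1 - p) / (real x - 1 + offset) - 1 / (real x + offset)))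
    \<le> - (K / (real x + offset)) * (growth / (real n + 1))" .
  have "drift_sum (\<lambda>A. K / (real (count A c) + offset)) A = K / (real x + offset)
     + real x / S * (p * (K / (real (x + 1) + offset)) + (1 - p) * (K / (real (x - 1) + offset)) - K / (real x + offset))"
    unfolding x_def S_def by (rule drift_sum_count[OF A, where g = "\<lambda>x. K / (real x + offset)"])
  also have "\<dots> = K / (real x + offset) + K / S * (real x * (p / (real x + 1 + offset)
       + (1 - p) / (real x - 1 + offset) - 1 / (real x + offset)))"
    using x by (simp add: algebra_simps of_nat_diff)
  finally show ?thesis using * unfolding x_def[symmetric] by (simp add: algebra_simps)
qed

text \<open>The potential is scaled to equal r at the death of c, where \<open>stop\<close> takes
  over; a single ball of c already lowers it to \<open>r * (offset / (1 + offset))\<close>.\<close>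

lemma death_bound:
  assumes c: "c \<in># x n" and B: "B \<in> sets M" and r: "r \<ge> 0"
    and stop: "\<And>n x. prob (cyl n x \<inter> B) \<le> r * prob (cyl n x)"
  shows "prob (cyl n x \<inter> {w \<in> space M. w \<in> B \<and> (\<exists>k\<ge>n. c \<notin># U k w)})
    \<le> r * (offset / (1 + offset)) * prob (cyl n x)"
proof -
  let ?V = "\<lambda>n A. r * offset / (real (count A c) + offset)"
  have "prob (cyl n x \<inter> {w \<in> space M. w \<in> B \<and> (\<exists>k\<ge>n. U k w \<in> {A. c \<notin># A})})
    \<le> ?V n (x n) * prob (cyl n x)"
  proof (rule maximal_inequality[where x = x and n = n and V = ?V and C = "{c}" and n0 = 0 and D = "\<lambda>_. {A. c \<notin># A}"])
    show "?V n A \<ge> 0" for n A using r offset_pos by simp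
    show "?V n (A + {#d#}) = ?V n A" if "d \<notin> {c}" for n A d using that by auto
    show "drift_sum (?V (Suc n)) A \<le> ?V n A" if "A \<notin> {A. c \<notin># A}" "size A \<le> Suc n" for n A
    proof -
      have "r * offset / (real (count A c) + offset) * (1 - growth / (real n + 1))
        \<le> r * offset / (real (count A c) + offset) * 1"
        using r offset_pos growth_pos by (intro mult_left_mono) auto
      moreover have "drift_sum (?V (Suc n)) A \<le> r * offset / (real (count A c) + offset) * (1 - growth / (real n + 1))"
        using that r offset_pos by (intro drift_sum_recip_le) auto
      ultimately show ?thesis by simp
    qed
    show "prob (cyl n x \<inter> B) \<le> ?V n (x n) * prob (cyl n x)" if "x n \<in> {A. c \<notin># A}" for n x
      using stop[of n x] that offset_pos by (simp add: not_in_iff)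
    show "{c} \<subseteq> past n x" using c by (auto simp: past_def)
  qed (use p01 B in auto)
  also have "?V n (x n) * prob (cyl n x) \<le> r * (offset / (1 + offset)) * prob (cyl n x)"
  proof -
    have "1 \<le> count (x n) c" using c by (simp add: Suc_le_eq)
    then have "offset / (real (count (x n) c) + offset) \<le> offset / (1 + offset)"
      using offset_pos by (intro divide_left_mono) auto
    then have "r * (offset / (real (count (x n) c) + offset)) \<le> r * (offset / (1 + offset))"
      using r by (intro mult_left_mono) auto
    then show ?thesis by (intro mult_right_mono) auto
  qed
  finally show ?thesis by simp
qed

lemma pred_mem [measurable]: "Measurable.pred M (\<lambda>w. c \<in># U k w)"
  by (rule pred_U)

text \<open>
  Total extinction requires the death of a colour and again total extinction from then on, so each
  iteration gains a factor $b/(1+b)$.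
\<close>

lemma AE_survivor: "AE w in M. \<exists>c m. \<forall>k\<ge>m. c \<in># U k w"
proof -
  define B where "B = {w \<in> space M. \<forall>c m. \<exists>k\<ge>m. c \<notin># U k w}"
  have B [measurable]: "B \<in> sets M" unfolding B_def by measurable
  define \<rho> where "\<rho> = offset / (1 + offset)"
  have \<rho>: "0 \<le> \<rho>" "\<rho> < 1" unfolding \<rho>_def using offset_pos by auto
  have le: "prob (cyl n x \<inter> B) \<le> \<rho> ^ j * prob (cyl n x)" for j n x
  proof (induction j arbitrary: n x)
    case 0
    show ?case by (auto intro!: finite_measure_mono)
  next
    case (Suc j n x)
    show ?case
    proof (cases "prob (cyl n x) > 0")
      case True
      then obtain c where c: "c \<in># x n" using cyl_size(1) by blast
      \<comment> \<open>On B every colour is absent at some time after n, so adding the death of c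
        costs nothing.\<close>
      have "cyl n x \<inter> B = cyl n x \<inter> {w \<in> space M. w \<in> B \<and> (\<exists>k\<ge>n. c \<notin># U k w)}"
        unfolding B_def by auto
      then show ?thesis using death_bound[of c x n B "\<rho> ^ j", OF c B] \<rho> Suc
        unfolding \<rho>_def[symmetric] by (simp add: mult_ac)
    next
      case False
      moreover have "prob (cyl n x \<inter> B) \<le> prob (cyl n x)" by (auto intro!: finite_measure_mono)
      ultimately show ?thesis using \<rho> by (smt (verit) measure_nonneg mult_nonneg_nonneg zero_le_power)
    qed
  qed
  have "(\<lambda>j. \<rho> ^ j * prob (cyl n x)) \<longlonglongrightarrow> 0 * prob (cyl n x)" for n x
    using \<rho> by (intro tendsto_mult LIMSEQ_realpow_zero tendsto_const) auto
  then have "prob (cyl n x \<inter> B) \<le> 0 * prob (cyl n x)" for n x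
    by (rule LIMSEQ_le_const) (use le in blast)
  then have "AE w in M. w \<notin> B"
    by (intro AE_cylI[of 0 "\<lambda>w. w \<notin> B", OF AE_cyl_notin[OF B]]) (simp add: measure_le_0_iff)
  with AE_space show ?thesis
    by eventually_elim (auto simp: B_def)
qed

text \<open>While c survives, the supermartingale reaches level \<Lambda> + 1 with probability at
  most its starting value divided by \<Lambda> + 1. Hence almost surely some level is never
  reached.\<close>

lemma AE_growth_aux:
  "AE w in M. (\<forall>k\<ge>m. c \<in># U k w) \<longrightarrow>
     (\<exists>\<Lambda>::nat. \<forall>k\<ge>m. (real k + 1) powr growth / (real (count (U k w) c) + offset) < real \<Lambda> + 1)"
proof -
  define B where "B = {w \<in> space M. \<forall>k\<ge>m. c \<in># U k w}"
  have B [measurable]: "B \<in> sets M" unfolding B_def by measurable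
  define f where "f k A = (real k + 1) powr growth / (real (count A c) + offset)" for k and A :: "'c multiset"
  \<comment> \<open>Death belongs to the stopping set because the drift bound needs a live colour;
    on B it does not occur.\<close>
  define D where "D \<Lambda> k = {A. c \<notin># A \<or> f k A \<ge> real \<Lambda> + 1}" for \<Lambda> :: nat and k
  have [measurable]: "Measurable.pred M (\<lambda>w. U k w \<in> D \<Lambda> k)" for k \<Lambda> by (rule pred_U)
  define N where "N = {w \<in> space M. w \<in> B \<and> (\<forall>\<Lambda>. \<exists>k\<ge>m. U k w \<in> D \<Lambda> k)}"
  have N [measurable]: "N \<in> sets M" unfolding N_def by measurable
  have f0: "f k A \<ge> 0" for k A unfolding f_def using offset_pos by simp
  have le: "prob (cyl m x \<inter> N) \<le> f m (x m) * inverse (real (Suc \<Lambda>)) * prob (cyl m x)" for x \<Lambda>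
  proof (cases "c \<in># x m")
    case False
    then have "cyl m x \<inter> N = {}" unfolding N_def B_def cyl_def by auto
    then show ?thesis using f0 by simp
  next
    case True
    let ?V = "\<lambda>n A. f n A * inverse (real (Suc \<Lambda>))"
    have "prob (cyl m x \<inter> N) \<le> prob (cyl m x \<inter> {w \<in> space M. w \<in> B \<and> (\<exists>k\<ge>m. U k w \<in> D \<Lambda> k)})"
      by (intro finite_measure_mono) (auto simp: N_def)
    also have "\<dots> \<le> ?V m (x m) * prob (cyl m x)"
    proof (rule maximal_inequality[where x = x and n = m and V = ?V and C = "{c}" and n0 = m and D = "D \<Lambda>"])
      show "?V n A \<ge> 0" for n A using f0 by simp
      show "?V n (A + {#d#}) = ?V n A" if "d \<notin> {c}" for n A d using that by (auto simp: f_def)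
      show "drift_sum (?V (Suc n)) A \<le> ?V n A" if "A \<notin> D \<Lambda> n" "size A \<le> Suc n" for n A
      proof -
        define K where "K n = (real n + 1) powr growth * inverse (real (Suc \<Lambda>))" for n
        have V: "?V n A = K n / (real (count A c) + offset)" for n A
          unfolding f_def K_def by simp
        have K0: "K n \<ge> 0" for n unfolding K_def by simp
        \<comment> \<open>The time factor grows by at most \<open>exp (growth / (n + 1))\<close>,
          which the loss \<open>1 - growth / (n + 1)\<close> compensates.\<close>
        have "K (Suc n) * (1 - growth / (real n + 1)) \<le> K n"
        proof -
          have "(real n + 1 + 1) powr growth \<le> (real n + 1) powr growth * exp (growth * 1 / (real n + 1))"
            using growth_pos by (intro powr_add_le) auto
          then have "K (Suc n) \<le> K n * exp (growth / (real n + 1))"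
            unfolding K_def by (simp add: add_ac divide_right_mono)
          moreover have "1 - growth / (real n + 1) \<le> exp (- growth / (real n + 1))"
            using exp_ge_add_one_self[of "- growth / (real n + 1)"] by simp
          ultimately have "K (Suc n) * (1 - growth / (real n + 1))
              \<le> K (Suc n) * exp (- growth / (real n + 1))"
            "K (Suc n) * exp (- growth / (real n + 1))
              \<le> K n * exp (growth / (real n + 1)) * exp (- growth / (real n + 1))"
            using K0 by (auto intro!: mult_left_mono mult_right_mono)
          moreover have "K n * exp (growth / (real n + 1)) * exp (- growth / (real n + 1)) = K n"
            by (simp add: mult.assoc flip: exp_add)
          ultimately show ?thesis by linarith
        qed
        then have "K (Suc n) * (1 - growth / (real n + 1)) / (real (count A c) + offset)
            \<le> K n / (real (count A c) + offset)"
          using offset_pos by (intro divide_right_mono) auto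
        moreover have "drift_sum (\<lambda>A. K (Suc n) / (real (count A c) + offset)) A
          \<le> K (Suc n) / (real (count A c) + offset) * (1 - growth / (real n + 1))"
          using that K0 by (intro drift_sum_recip_le) (auto simp: D_def)
        ultimately show ?thesis unfolding V by simp
      qed
      show "prob (cyl n x \<inter> B) \<le> ?V n (x n) * prob (cyl n x)" if "n \<ge> m" "x n \<in> D \<Lambda> n" for n x
      proof (cases "c \<in># x n")
        case True
        then have "f n (x n) \<ge> real (Suc \<Lambda>)" using that unfolding D_def by auto
        then have "1 \<le> ?V n (x n)" by (simp add: field_simps)
        then have "1 * prob (cyl n x) \<le> ?V n (x n) * prob (cyl n x)" by (intro mult_right_mono) auto
        moreover have "prob (cyl n x \<inter> B) \<le> prob (cyl n x)" by (auto intro!: finite_measure_mono)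
        ultimately show ?thesis by simp
      next
        case False
        then have "cyl n x \<inter> B = {}" using that(1) unfolding B_def cyl_def by auto
        then show ?thesis using f0 by simp
      qed
      show "{c} \<subseteq> past m x" using True by (auto simp: past_def)
    qed (use p01 B in auto)
    finally show ?thesis .
  qed
  have "(\<lambda>\<Lambda>. f m (x m) * inverse (real (Suc \<Lambda>)) * prob (cyl m x)) \<longlonglongrightarrow> f m (x m) * 0 * prob (cyl m x)" for x
    by (intro tendsto_mult LIMSEQ_inverse_real_of_nat tendsto_const)
  then have "prob (cyl m x \<inter> N) \<le> f m (x m) * 0 * prob (cyl m x)" for x
    by (rule LIMSEQ_le_const) (use le in blast)
  then have "AE w in M. w \<notin> N"
    by (intro AE_cylI[of m "\<lambda>w. w \<notin> N", OF AE_cyl_notin[OF N]]) (simp add: measure_le_0_iff)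
  with AE_space show ?thesis
  proof eventually_elim
    case (elim w)
    show ?case
    proof
      assume al: "\<forall>k\<ge>m. c \<in># U k w"
      then have "w \<in> B" using elim(1) by (simp add: B_def)
      then obtain \<Lambda> where "\<And>k. k \<ge> m \<Longrightarrow> U k w \<notin> D \<Lambda> k"
        using elim unfolding N_def by auto
      then show "\<exists>\<Lambda>::nat. \<forall>k\<ge>m. (real k + 1) powr growth / (real (count (U k w) c) + offset) < real \<Lambda> + 1"
        unfolding D_def f_def by (intro exI[of _ \<Lambda>]) (auto simp: not_le)
    qed
  qed
qed

text \<open>The random constant is the reciprocal of a natural number, so that the events
  \<open>catch c j s\<close> formed with it are countably many.\<close>

lemma AE_growth:
  "AE w in M. \<forall>c m. (\<forall>k\<ge>m. c \<in># U k w) \<longrightarrow>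
     (\<exists>j. \<forall>k\<ge>m. (real k + 1) powr growth / real (Suc j) \<le> real (count (U k w) c))"
proof -
  have "AE w in M. \<forall>c m. (\<forall>k\<ge>m. c \<in># U k w) \<longrightarrow>
     (\<exists>\<Lambda>::nat. \<forall>k\<ge>m. (real k + 1) powr growth / (real (count (U k w) c) + offset) < real \<Lambda> + 1)"
    using AE_growth_aux by (simp add: AE_all_countable)
  then show ?thesis
  proof eventually_elim
    case (elim w)
    show ?case
    proof (intro allI impI)
      fix c m assume al: "\<forall>k\<ge>m. c \<in># U k w"
      then obtain \<Lambda> :: nat where \<Lambda>: "\<And>k. k \<ge> m \<Longrightarrow>
          (real k + 1) powr growth / (real (count (U k w) c) + offset) < real \<Lambda> + 1"
        using elim by blast
      \<comment> \<open>For a live colour x + offset <= x * (1 + offset), so the shift only changes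
        the constant.\<close>
      obtain j :: nat where j: "(real \<Lambda> + 1) * (1 + offset) \<le> real j" using real_arch_simple by blast
      have "(real k + 1) powr growth / real (Suc j) \<le> real (count (U k w) c)" if k: "k \<ge> m" for k
      proof -
        let ?x = "real (count (U k w) c)"
        have x: "?x \<ge> 1" using al k by (simp add: Suc_le_eq flip: count_greater_zero_iff)
        have "(real k + 1) powr growth \<le> (real \<Lambda> + 1) * (?x + offset)"
          using \<Lambda>[OF k] x offset_pos by (simp add: pos_divide_less_eq)
        also have "\<dots> \<le> (real \<Lambda> + 1) * (?x * (1 + offset))"
          using x offset_pos mult_right_mono[of 1 ?x offset] by (intro mult_left_mono) (auto simp: algebra_simps)
        also have "\<dots> = (real \<Lambda> + 1) * (1 + offset) * ?x" by simp
        also have "\<dots> \<le> real (Suc j) * ?x" using j x by (intro mult_right_mono) auto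
        finally show ?thesis by (simp add: pos_divide_le_eq mult.commute)
      qed
      then show "\<exists>j. \<forall>k\<ge>m. (real k + 1) powr growth / real (Suc j) \<le> real (count (U k w) c)" by blast
    qed
  qed
qed

section \<open>Comparison of two colours\<close>

definition \<theta> :: real where "\<theta> = drift / 64"

text \<open>From here on both conditions on t in \<open>tie_potential_drift\<close> hold.\<close>

definition threshold :: nat where "threshold = nat \<lceil>max 4 (1 / drift)\<rceil>"

text \<open>
  Below \<open>threshold\<close> the potential is frozen, which bounds it from below on the stopping set.
\<close>

definition pair_pot :: "nat \<Rightarrow> nat \<Rightarrow> real" where
  "pair_pot x y = tie_potential \<theta> (\<theta> / 4) (real (max (x + y) threshold)) (real x - real y)"

lemma \<theta>_pos: "\<theta> > 0" using drift_pos by (simp add: \<theta>_def)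

lemma threshold_ge: "real threshold \<ge> 4" "real threshold \<ge> 1 / drift"
proof -
  have "real threshold \<ge> max 4 (1 / drift)" unfolding threshold_def by linarith
  then show "real threshold \<ge> 4" "real threshold \<ge> 1 / drift" by auto
qed

lemma pair_pot_nonneg: "pair_pot x y \<ge> 0"
  by (simp add: pair_pot_def tie_potential_def)

lemma pair_pot_drift:
  assumes "x + y > threshold"
  shows "real x * (p * pair_pot (x + 1) y + (1 - p) * pair_pot (x - 1) y - pair_pot x y)
    + real y * (p * pair_pot x (y + 1) + (1 - p) * pair_pot x (y - 1) - pair_pot x y) \<le> 0"
proof -
  define t where "t = real (x + y)"
  define d where "d = real x - real y"
  let ?T = "tie_potential \<theta> (\<theta> / 4)"
  have t: "t \<ge> 4" "t \<ge> 1 / drift" "t > 0" using assms threshold_ge unfolding t_def by linarith+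
  have d: "\<bar>d\<bar> \<le> t" unfolding d_def t_def by linarith
  have "t * ((1 + d / t) / 2 * (p * ?T (t + 1) (d + 1) + (1 - p) * ?T (t - 1) (d - 1))
       + (1 - d / t) / 2 * (p * ?T (t + 1) (d - 1) + (1 - p) * ?T (t - 1) (d + 1))) \<le> t * ?T t d"
    using t(3) by (intro mult_left_mono tie_potential_drift[OF p_lt drift_def drift_pos \<theta>_def refl t(1,2) d]) auto
  moreover have "t * ((1 + d / t) / 2 * u1 + (1 - d / t) / 2 * u2) = real x * u1 + real y * u2" for u1 u2
  proof -
    have "t * ((1 + d / t) / 2 * u1 + (1 - d / t) / 2 * u2) = (t + d) / 2 * u1 + (t - d) / 2 * u2"
      using t(3) by (simp add: field_simps)
    moreover have "(t + d) / 2 = real x" "(t - d) / 2 = real y" unfolding t_def d_def by auto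
    ultimately show ?thesis by simp
  qed
  \<comment> \<open>The strict inequality in the assumption keeps the total at or above the
    threshold after losing a ball, so the maximum in \<open>pair_pot\<close> is inactive at all
    neighbours.\<close>
  moreover have T: "pair_pot x' y' = ?T (real x' + real y') (real x' - real y')" if "x' + y' \<ge> threshold" for x' y'
    using that by (simp add: pair_pot_def max_def)
  moreover have "real x * (p * pair_pot (x + 1) y + (1 - p) * pair_pot (x - 1) y - pair_pot x y)
      = real x * (p * ?T (t + 1) (d + 1) + (1 - p) * ?T (t - 1) (d - 1) - ?T t d)"
    using assms unfolding t_def d_def by (cases x) (simp_all add: T algebra_simps)
  moreover have "real y * (p * pair_pot x (y + 1) + (1 - p) * pair_pot x (y - 1) - pair_pot x y)
      = real y * (p * ?T (t + 1) (d - 1) + (1 - p) * ?T (t - 1) (d + 1) - ?T t d)"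
    using assms unfolding t_def d_def by (cases y) (simp_all add: T algebra_simps)
  moreover have "t * ?T t d = real x * ?T t d + real y * ?T t d" unfolding t_def by (simp add: distrib_right)
  ultimately show ?thesis by (simp add: right_diff_distrib)
qed

lemma drift_sum_pair_pot_le:
  assumes "a \<noteq> b" "A \<noteq> {#}" "count A a + count A b > threshold" "K \<ge> 0"
  shows "drift_sum (\<lambda>A. pair_pot (count A a) (count A b) * K) A \<le> pair_pot (count A a) (count A b) * K"
proof -
  let ?x = "count A a" and ?y = "count A b"
  have "drift_sum (\<lambda>A. pair_pot (count A a) (count A b) * K) A = pair_pot ?x ?y * K
    + (real ?x * (p * (pair_pot (?x + 1) ?y * K) + (1 - p) * (pair_pot (?x - 1) ?y * K) - pair_pot ?x ?y * K)
     + real ?y * (p * (pair_pot ?x (?y + 1) * K) + (1 - p) * (pair_pot ?x (?y - 1) * K) - pair_pot ?x ?y * K))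
     / real (size A)"
    by (rule drift_sum_count2[OF assms(2,1), where g = "\<lambda>x y. pair_pot x y * K"])
  also have "\<dots> = pair_pot ?x ?y * K
    + (real ?x * (p * pair_pot (?x + 1) ?y + (1 - p) * pair_pot (?x - 1) ?y - pair_pot ?x ?y)
     + real ?y * (p * pair_pot ?x (?y + 1) + (1 - p) * pair_pot ?x (?y - 1) - pair_pot ?x ?y)) * K
     / real (size A)"
    by (simp add: algebra_simps)
  also have "\<dots> \<le> pair_pot ?x ?y * K"
    using pair_pot_drift[OF assms(3)] assms(4)
    by (simp add: divide_nonpos_nonneg mult_nonpos_nonneg)
  finally show ?thesis .
qed

text \<open>At a tie with total at least N + 1 the potential is at least (N + 1)^\<gamma>, so such a
  tie has probability of order (N + 1)^(-\<gamma>), which tends to 0. Small totals are part of the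
  stopping set and are excluded by B.\<close>

lemma AE_large_ties_aux:
  assumes "a \<noteq> b"
  shows "AE w in M. a \<in> past m (\<lambda>n. U n w) \<longrightarrow> b \<in> past m (\<lambda>n. U n w) \<longrightarrow>
    (\<forall>k\<ge>m. threshold < count (U k w) a + count (U k w) b) \<longrightarrow>
    (\<exists>N. \<forall>k\<ge>m. count (U k w) a = count (U k w) b \<longrightarrow> count (U k w) a + count (U k w) b < N)"
proof (rule AE_cylI[of m])
  fix x
  define B where "B = {w \<in> space M. \<forall>k\<ge>m. threshold < count (U k w) a + count (U k w) b}"
  have [measurable]: "Measurable.pred M (\<lambda>w. threshold < count (U k w) a + count (U k w) b)" for k
    by (rule pred_U[of "\<lambda>A. threshold < count A a + count A b"])
  have B [measurable]: "B \<in> sets M" unfolding B_def by measurable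
  define D where "D N k = {A. count A a + count A b \<le> threshold
     \<or> count A a = count A b \<and> count A a + count A b \<ge> Suc N}" for N k :: nat
  have [measurable]: "Measurable.pred M (\<lambda>w. U k w \<in> D N k)" for k N by (rule pred_U)
  define Bad where "Bad = {w \<in> space M. w \<in> B \<and> (\<forall>N. \<exists>k\<ge>m. U k w \<in> D N k)}"
  have Bad [measurable]: "Bad \<in> sets M" unfolding Bad_def by measurable
  let ?g = "\<theta> / 4"
  show "AE w in M. w \<in> cyl m x \<longrightarrow> a \<in> past m (\<lambda>n. U n w) \<longrightarrow> b \<in> past m (\<lambda>n. U n w) \<longrightarrow>
    (\<forall>k\<ge>m. threshold < count (U k w) a + count (U k w) b) \<longrightarrow>
    (\<exists>N. \<forall>k\<ge>m. count (U k w) a = count (U k w) b \<longrightarrow> count (U k w) a + count (U k w) b < N)"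
  proof (cases "a \<in> past m x \<and> b \<in> past m x")
    case False
    show ?thesis
    proof (intro AE_I2 impI)
      fix w assume "w \<in> cyl m x" "a \<in> past m (\<lambda>n. U n w)" "b \<in> past m (\<lambda>n. U n w)"
      then show "\<exists>N. \<forall>k\<ge>m. count (U k w) a = count (U k w) b \<longrightarrow> count (U k w) a + count (U k w) b < N"
        using False past_cyl[of w m x] by simp
    qed
  next
    case True
    let ?v = "\<lambda>A. pair_pot (count A a) (count A b)"
    have le: "prob (cyl m x \<inter> Bad) \<le> ?v (x m) * real (Suc N) powr (- ?g) * prob (cyl m x)" for N
    proof -
      let ?V = "\<lambda>n A. ?v A * real (Suc N) powr (- ?g)"
      have "prob (cyl m x \<inter> Bad) \<le> prob (cyl m x \<inter> {w \<in> space M. w \<in> B \<and> (\<exists>k\<ge>m. U k w \<in> D N k)})"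
        by (intro finite_measure_mono) (auto simp: Bad_def)
      also have "\<dots> \<le> ?V m (x m) * prob (cyl m x)"
      proof (rule maximal_inequality[where x = x and n = m and V = ?V and C = "{a, b}" and n0 = m and D = "D N"])
        show "?V n A \<ge> 0" for n A using pair_pot_nonneg by simp
        show "?V n (A + {#d#}) = ?V n A" if "d \<notin> {a, b}" for n A d using that by auto
        show "drift_sum (?V (Suc n)) A \<le> ?V n A" if "A \<notin> D N n" "A \<noteq> {#}" for n A
          using that by (intro drift_sum_pair_pot_le assms) (auto simp: D_def)
        show "prob (cyl n x \<inter> B) \<le> ?V n (x n) * prob (cyl n x)" if "n \<ge> m" "x n \<in> D N n" for n x
        proof (cases "count (x n) a + count (x n) b \<le> threshold")
          case True
          then have "cyl n x \<inter> B = {}" using that(1) unfolding B_def cyl_def by fastforce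
          then show ?thesis using pair_pot_nonneg by simp
        next
          case False
          then have tie: "count (x n) a = count (x n) b" "count (x n) a + count (x n) b \<ge> Suc N"
            using that(2) unfolding D_def by auto
          have "real (Suc N) powr ?g \<le> real (max (count (x n) a + count (x n) b) threshold) powr ?g"
            using tie(2) \<theta>_pos by (intro powr_mono2) auto
          also have "\<dots> = ?v (x n)" using tie(1) by (simp add: pair_pot_def tie_potential_def)
          finally have "real (Suc N) powr ?g * real (Suc N) powr (- ?g) \<le> ?V n (x n)"
            by (intro mult_right_mono) auto
          then have "1 \<le> ?V n (x n)" by (simp flip: powr_add)
          then have "1 * prob (cyl n x) \<le> ?V n (x n) * prob (cyl n x)" by (intro mult_right_mono) auto
          moreover have "prob (cyl n x \<inter> B) \<le> prob (cyl n x)" by (auto intro!: finite_measure_mono)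
          ultimately show ?thesis by simp
        qed
        show "{a, b} \<subseteq> past m x" using True by simp
      qed (use p01 B in auto)
      finally show ?thesis .
    qed
    have "(\<lambda>N. ?v (x m) * real (Suc N) powr (- ?g) * prob (cyl m x)) \<longlonglongrightarrow> ?v (x m) * 0 * prob (cyl m x)"
      using \<theta>_pos
      by (intro tendsto_mult tendsto_const tendsto_neg_powr
            filterlim_compose[OF filterlim_real_sequentially filterlim_Suc]) auto
    then have "prob (cyl m x \<inter> Bad) \<le> ?v (x m) * 0 * prob (cyl m x)"
      by (rule LIMSEQ_le_const) (use le in blast)
    then have "AE w in M. w \<in> cyl m x \<longrightarrow> w \<notin> Bad"
      by (intro AE_cyl_notin[OF Bad]) (simp add: measure_le_0_iff)
    with AE_space show ?thesis
    proof eventually_elim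
      case (elim w)
      show ?case
      proof (intro impI)
        assume "w \<in> cyl m x" and al: "\<forall>k\<ge>m. threshold < count (U k w) a + count (U k w) b"
        then have "w \<in> B" using elim(1) by (simp add: B_def)
        then obtain N where "\<And>k. k \<ge> m \<Longrightarrow> U k w \<notin> D N k"
          using elim \<open>w \<in> cyl m x\<close> unfolding Bad_def by auto
        then show "\<exists>N. \<forall>k\<ge>m. count (U k w) a = count (U k w) b \<longrightarrow> count (U k w) a + count (U k w) b < N"
          unfolding D_def by (intro exI[of _ "Suc N"]) (auto simp: not_le)
      qed
    qed
  qed
qed

lemma AE_large_ties:
  "AE w in M. \<forall>a b m. a \<noteq> b \<longrightarrow> a \<in> past m (\<lambda>n. U n w) \<longrightarrow> b \<in> past m (\<lambda>n. U n w) \<longrightarrow>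
    (\<forall>k\<ge>m. threshold < count (U k w) a + count (U k w) b) \<longrightarrow>
    (\<exists>N. \<forall>k\<ge>m. count (U k w) a = count (U k w) b \<longrightarrow> count (U k w) a + count (U k w) b < N)"
  unfolding AE_all_countable
proof (intro allI)
  fix a b m
  show "AE w in M. a \<noteq> b \<longrightarrow> a \<in> past m (\<lambda>n. U n w) \<longrightarrow> b \<in> past m (\<lambda>n. U n w) \<longrightarrow>
    (\<forall>k\<ge>m. threshold < count (U k w) a + count (U k w) b) \<longrightarrow>
    (\<exists>N. \<forall>k\<ge>m. count (U k w) a = count (U k w) b \<longrightarrow> count (U k w) a + count (U k w) b < N)"
    using AE_large_ties_aux[of a b m] by (cases "a = b") auto
qed

section \<open>New colours catching up with an established one\<close>

definition meets :: "'c \<Rightarrow> 'c \<Rightarrow> 'c multiset set" where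
  "meets c d = {A. count A c + count A d \<le> threshold \<or> count A c = count A d}"

text \<open>Here freezing pays off: for small totals d^2 / t is at most the threshold, and at a tie
  the exponent vanishes. After multiplication by \<open>exp (\<theta> * real threshold)\<close> the
  potential is therefore at least 1 on \<open>meets\<close>.\<close>

lemma pair_pot_meets: "count A c + count A d \<le> threshold \<or> count A c = count A d
    \<Longrightarrow> exp (- \<theta> * real threshold) \<le> pair_pot (count A c) (count A d)"
proof -
  let ?x = "count A c" and ?y = "count A d"
  let ?t = "real (max (?x + ?y) threshold)" and ?d = "real ?x - real ?y"
  assume "?x + ?y \<le> threshold \<or> ?x = ?y"
  then have "exp (- \<theta> * real threshold) \<le> exp (- \<theta> * ?d\<^sup>2 / ?t)"
  proof
    assume xy: "?x + ?y \<le> threshold"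
    then have t: "?t = real threshold" by simp
    have "?d\<^sup>2 \<le> (real threshold)\<^sup>2" using xy by (intro power2_le_iff_abs_le[THEN iffD2]) auto
    then have "\<theta> * ?d\<^sup>2 \<le> \<theta> * real threshold * real threshold" using \<theta>_pos by (simp add: power2_eq_square)
    then show ?thesis unfolding t using threshold_ge(1) by (simp add: pos_divide_le_eq)
  next
    assume "?x = ?y"
    then show ?thesis using \<theta>_pos by simp
  qed
  moreover have "1 \<le> ?t powr (\<theta> / 4)"
    using threshold_ge(1) \<theta>_pos by (intro ge_one_powr_ge_zero) auto
  ultimately have "1 * exp (- \<theta> * real threshold) \<le> ?t powr (\<theta> / 4) * exp (- \<theta> * ?d\<^sup>2 / ?t)"
    by (intro mult_mono) auto
  then show ?thesis by (simp add: pair_pot_def tie_potential_def)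
qed

text \<open>The first summand serves large counts of c, where \<open>pair_pot_one_le\<close>
  applies; the second makes the bound exceed 1 for counts below the threshold.\<close>

definition catch_const :: real where
  "catch_const = exp (3 * \<theta>) * exp (\<theta> * real threshold) + exp (\<theta> * real threshold)"

text \<open>(a - 1)^2 / (a + 1) >= a - 3 gives decay at rate \<theta>; half of it is given up to
  absorb the power of a + 1.\<close>

lemma pair_pot_one_le:
  assumes "a + 1 \<ge> threshold"
  shows "pair_pot a 1 \<le> exp (3 * \<theta>) * exp (- (\<theta> / 2) * real a)"
proof -
  have a: "a \<ge> 3" using assms threshold_ge(1) by linarith
  have "(1 + real a) powr (\<theta> / 4) \<le> 1 powr (\<theta> / 4) * exp (\<theta> / 4 * real a / 1)"
    using \<theta>_pos by (intro powr_add_le) auto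
  also have "\<dots> \<le> exp (\<theta> / 2 * real a)" using \<theta>_pos by simp
  finally have 1: "(1 + real a) powr (\<theta> / 4) \<le> exp (\<theta> / 2 * real a)" .
  have "(real a - 3) * (1 + real a) \<le> (real a - 1)\<^sup>2"
    by (simp add: power2_eq_square algebra_simps)
  then have "\<theta> * (real a - 3) \<le> \<theta> * ((real a - 1)\<^sup>2 / (1 + real a))"
    using \<theta>_pos by (intro mult_left_mono) (auto simp: pos_le_divide_eq)
  then have "exp (- \<theta> * (real a - 1)\<^sup>2 / (1 + real a)) \<le> exp (3 * \<theta> - \<theta> * real a)"
    by (simp add: algebra_simps)
  with 1 have "(1 + real a) powr (\<theta> / 4) * exp (- \<theta> * (real a - 1)\<^sup>2 / (1 + real a))
     \<le> exp (\<theta> / 2 * real a) * exp (3 * \<theta> - \<theta> * real a)"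
    by (intro mult_mono) auto
  also have "\<dots> = exp (3 * \<theta>) * exp (- (\<theta> / 2) * real a)"
    by (simp flip: exp_add)
  finally show ?thesis using assms by (simp add: pair_pot_def tie_potential_def max_def add.commute)
qed

text \<open>The lower bound on the count of c is part of the event, which makes the estimate of its
  probability deterministic; s + 2 is the birth time of d plus one, as in
  \<open>AE_growth\<close>.\<close>

definition catch :: "'c \<Rightarrow> nat \<Rightarrow> nat \<Rightarrow> 'w set" where
  "catch c j s = {w \<in> space M. (real s + 2) powr growth / real (Suc j) \<le> real (count (U (Suc s) w) c)
     \<and> (\<exists>d. d \<noteq> c \<and> d \<notin> past s (\<lambda>m. U m w) \<and> d \<in># U (Suc s) w
         \<and> (\<exists>k\<ge>Suc s. U k w \<in> meets c d))}"

lemma sets_catch [measurable]: "catch c j s \<in> sets M"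
proof -
  have combine: "{w \<in> space M. P w \<and> (\<exists>d. d \<noteq> c \<and> \<not> Q d w \<and> R d w \<and> (\<exists>k\<ge>Suc s. S d k w))} \<in> sets M"
    if [measurable]: "Measurable.pred M P" "\<And>d. Measurable.pred M (Q d)" "\<And>d. Measurable.pred M (R d)"
      "\<And>d k. Measurable.pred M (S d k)" for P Q R S
    by measurable
  show ?thesis unfolding catch_def
    by (rule combine; rule pred_U pred_past pred_mem)
qed

text \<open>The cylinder determines the newborn colour, so the union over d has a single term, and
  the potential starts from the pair (a, 1) with a at least h.\<close>

lemma prob_catch_cyl:
  "prob (cyl (Suc s) x \<inter> catch c j s)
    \<le> catch_const * exp (- (\<theta> / 2 * ((real s + 2) powr growth / real (Suc j)))) * prob (cyl (Suc s) x)"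
proof -
  define h where "h = (real s + 2) powr growth / real (Suc j)"
  have h: "h > 0" unfolding h_def by simp
  have cc: "catch_const \<ge> 0" unfolding catch_const_def by simp
  consider "prob (cyl (Suc s) x) = 0" | "cyl (Suc s) x \<inter> catch c j s = {}"
    | w where "prob (cyl (Suc s) x) > 0" "w \<in> cyl (Suc s) x" "w \<in> catch c j s"
    using measure_nonneg[of M "cyl (Suc s) x"] by fastforce
  then show ?thesis
  proof cases
    case 1
    have "prob (cyl (Suc s) x \<inter> catch c j s) \<le> prob (cyl (Suc s) x)" by (auto intro!: finite_measure_mono)
    then show ?thesis using 1 by simp
  next
    case 2
    then show ?thesis using cc by simp
  next
    case 3
    have eq: "past s (\<lambda>m. U m w') = past s x" "U (Suc s) w' = x (Suc s)" if "w' \<in> cyl (Suc s) x" for w'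
      using that by (auto simp: cyl_def intro!: past_cong)
    from 3 obtain d where d: "d \<noteq> c" "d \<notin> past s x" "d \<in># x (Suc s)"
      and hc: "h \<le> real (count (x (Suc s)) c)"
      using eq[OF 3(2)] unfolding catch_def h_def by auto
    obtain c' d' where step: "d' \<notin> past s x" "x (Suc s) = x s - {#c'#} + {#d'#}"
    proof -
      from cyl_valid_step[OF 3(1)] obtain c' where "c' \<in># x s" "x (Suc s) = x s + {#c'#}
          \<or> (\<exists>d. d \<notin> past s x \<and> x (Suc s) = x s - {#c'#} + {#d#})"
        unfolding valid_step_def by blast
      moreover have "x (Suc s) \<noteq> x s + {#c'#}" using d(2,3) \<open>c' \<in># x s\<close> by (auto simp: past_def)
      ultimately show ?thesis using that by blast
    qed
    have only: "e = d'" if "e \<notin> past s x" "e \<in># x (Suc s)" for e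
      using that step(2) by (auto simp: past_def dest: in_diffD)
    have dd: "d = d'" using only d by blast
    have d1: "count (x (Suc s)) d = 1"
      using d(2) step(2) unfolding dd by (auto simp: past_def not_in_iff)
    define a where "a = count (x (Suc s)) c"
    have a: "h \<le> real a" "a > 0" using hc h unfolding a_def by (auto simp del: count_greater_zero_iff)
    have "prob (cyl (Suc s) x \<inter> catch c j s) \<le> catch_const * exp (- (\<theta> / 2) * real a) * prob (cyl (Suc s) x)"
    proof (cases "a + 1 \<ge> threshold")
      case False
      have "real a \<le> real threshold" using False by simp
      then have "\<theta> * real a \<le> \<theta> * real threshold" using \<theta>_pos by simp
      then have "0 \<le> \<theta> * real threshold + - (\<theta> / 2) * real a" using \<theta>_pos by simp
      then have "1 \<le> exp (\<theta> * real threshold) * exp (- (\<theta> / 2) * real a)"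
        by (simp flip: exp_add)
      also have "\<dots> \<le> catch_const * exp (- (\<theta> / 2) * real a)"
        unfolding catch_const_def by (intro mult_right_mono) auto
      finally have "1 * prob (cyl (Suc s) x) \<le> catch_const * exp (- (\<theta> / 2) * real a) * prob (cyl (Suc s) x)"
        by (intro mult_right_mono) auto
      moreover have "prob (cyl (Suc s) x \<inter> catch c j s) \<le> prob (cyl (Suc s) x)"
        by (auto intro!: finite_measure_mono)
      ultimately show ?thesis by simp
    next
      case True
      \<comment> \<open>The extra factor normalises the potential to at least 1 on the stopping set,
        see \<open>pair_pot_meets\<close>.\<close>
      let ?V = "\<lambda>n A. pair_pot (count A c) (count A d) * exp (\<theta> * real threshold)"
      have "prob (cyl (Suc s) x \<inter> catch c j s)
        \<le> prob (cyl (Suc s) x \<inter> {w \<in> space M. w \<in> space M \<and> (\<exists>k\<ge>Suc s. U k w \<in> meets c d)})"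
      proof (intro finite_measure_mono subsetI)
        fix w assume w: "w \<in> cyl (Suc s) x \<inter> catch c j s"
        then obtain e k where "e \<notin> past s x" "e \<in># x (Suc s)" "k \<ge> Suc s" "U k w \<in> meets c e"
          using eq[of w] unfolding catch_def by auto
        moreover from this have "e = d" using only dd by simp
        ultimately show "w \<in> cyl (Suc s) x \<inter> {w \<in> space M. w \<in> space M \<and> (\<exists>k\<ge>Suc s. U k w \<in> meets c d)}"
          using w by (auto simp: cyl_def)
      next
        have [measurable]: "Measurable.pred M (\<lambda>w. U k w \<in> meets c d)" for k by (rule pred_U)
        show "cyl (Suc s) x \<inter> {w \<in> space M. w \<in> space M \<and> (\<exists>k\<ge>Suc s. U k w \<in> meets c d)} \<in> sets M"
          by measurable
      qed
      also have "\<dots> \<le> ?V (Suc s) (x (Suc s)) * prob (cyl (Suc s) x)"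
      proof (rule maximal_inequality[where x = x and n = "Suc s" and V = ?V and C = "{c, d}" and n0 = 0
            and D = "\<lambda>_. meets c d"])
        show "?V n A \<ge> 0" for n A using pair_pot_nonneg by simp
        show "?V n (A + {#e#}) = ?V n A" if "e \<notin> {c, d}" for n A e using that by auto
        show "drift_sum (?V (Suc n)) A \<le> ?V n A" if "A \<notin> meets c d" "A \<noteq> {#}" for n A
          using that d(1) by (intro drift_sum_pair_pot_le) (auto simp: meets_def)
        show "prob (cyl n x \<inter> space M) \<le> ?V n (x n) * prob (cyl n x)" if "x n \<in> meets c d" for n x
        proof -
          have "exp (- \<theta> * real threshold) * exp (\<theta> * real threshold) \<le> ?V n (x n)"
            using that pair_pot_meets[of "x n" c d] by (intro mult_right_mono) (auto simp: meets_def)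
          then have "1 \<le> ?V n (x n)" by (simp flip: exp_add)
          then have "1 * prob (cyl n x) \<le> ?V n (x n) * prob (cyl n x)" by (intro mult_right_mono) auto
          then show ?thesis by (simp add: sets.Int_space_eq2)
        qed
        show "{c, d} \<subseteq> past (Suc s) x" using d(3) a(2) unfolding a_def by (auto simp: past_def)
      qed (use p01 in auto)
      also have "?V (Suc s) (x (Suc s)) \<le> catch_const * exp (- (\<theta> / 2) * real a)"
      proof -
        have "pair_pot a 1 * exp (\<theta> * real threshold)
            \<le> exp (3 * \<theta>) * exp (- (\<theta> / 2) * real a) * exp (\<theta> * real threshold)"
          using pair_pot_one_le[OF True] by (intro mult_right_mono) auto
        also have "\<dots> \<le> catch_const * exp (- (\<theta> / 2) * real a)"
          unfolding catch_const_def by (simp add: algebra_simps)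
        finally show ?thesis unfolding a_def[symmetric] d1 .
      qed
      finally show ?thesis by (simp add: mult_right_mono)
    qed
    also have "\<dots> \<le> catch_const * exp (- (\<theta> / 2 * h)) * prob (cyl (Suc s) x)"
      using cc a(1) \<theta>_pos by (intro mult_right_mono mult_left_mono) auto
    finally show ?thesis by (simp add: h_def)
  qed
qed

lemma AE_eventually_no_catch: "AE w in M. \<forall>c j. \<exists>s0. \<forall>s\<ge>s0. w \<notin> catch c j s"
  unfolding AE_all_countable
proof (intro allI)
  fix c j
  have le: "prob (catch c j s) \<le> catch_const * exp (- (\<theta> / 2 / real (Suc j) * (real s + 2) powr growth))" for s
    using prob_le_cylI[OF sets_catch[of c j s] _ prob_catch_cyl[of s _ c j]] by (simp add: catch_const_def)
  have "summable (\<lambda>s. catch_const * exp (- (\<theta> / 2 / real (Suc j) * (real s + 2) powr growth)))"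
    using \<theta>_pos growth_pos by (intro summable_mult summable_exp_neg_powr) auto
  then have "summable (\<lambda>s. prob (catch c j s))"
    by (rule summable_comparison_test') (use le in auto)
  then have "AE w in M. eventually (\<lambda>s. w \<in> space M - catch c j s) sequentially"
    by (intro borel_cantelli_AE1) (auto simp: emeasure_eq_measure)
  then show "AE w in M. \<exists>s0. \<forall>s\<ge>s0. w \<notin> catch c j s"
    by eventually_elim (auto simp: eventually_sequentially)
qed

section \<open>The dominating colour\<close>

text \<open>The deterministic part, for a single path. Colours born after s0 stay below c, which
  leaves the finite set \<open>past s0 x\<close> to be ranked.\<close>

lemma dominating_if_path_properties:
  assumes valid: "\<And>n. valid_step n x"
    and alive: "\<And>k. k \<ge> m \<Longrightarrow> c \<in># x k"
    and grow: "\<And>k. k \<ge> m \<Longrightarrow> (real k + 1) powr growth / real (Suc j) \<le> real (count (x k) c)"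
    and ties: "\<And>a b m. a \<noteq> b \<Longrightarrow> a \<in> past m x \<Longrightarrow> b \<in> past m x
      \<Longrightarrow> \<forall>k\<ge>m. threshold < count (x k) a + count (x k) b
      \<Longrightarrow> \<exists>N. \<forall>k\<ge>m. count (x k) a = count (x k) b \<longrightarrow> count (x k) a + count (x k) b < N"
    and catch: "\<And>s d k. s \<ge> s1 \<Longrightarrow> (real s + 2) powr growth / real (Suc j) \<le> real (count (x (Suc s)) c)
      \<Longrightarrow> d \<noteq> c \<Longrightarrow> d \<notin> past s x \<Longrightarrow> d \<in># x (Suc s) \<Longrightarrow> k \<ge> Suc s \<Longrightarrow> x k \<notin> meets c d"
  shows "\<exists>c n0. \<forall>n\<ge>n0. has_most_balls c (x n)"
proof -
  have unb: "eventually (\<lambda>k. N \<le> count (x k) c) sequentially" for N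
  proof -
    have "filterlim (\<lambda>k. (real k + 1) powr growth / real (Suc j)) at_top sequentially"
      using growth_pos by real_asymp
    then have "eventually (\<lambda>k. real N \<le> (real k + 1) powr growth / real (Suc j)) sequentially"
      by (simp add: filterlim_at_top)
    with eventually_ge_at_top[of m] show ?thesis
    proof eventually_elim
      case (elim k)
      then show ?case using grow[of k] by linarith
    qed
  qed
  obtain s0 where s0: "s0 \<ge> m" "s0 \<ge> s1" "\<And>k. k \<ge> s0 \<Longrightarrow> threshold < count (x k) c"
  proof -
    obtain k0 where "\<And>k. k \<ge> k0 \<Longrightarrow> Suc threshold \<le> count (x k) c"
      using unb[of "Suc threshold"] by (auto simp: eventually_sequentially)
    then show ?thesis using that[of "max k0 (max m s1)"] by (auto simp: Suc_le_eq)
  qed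
  have late: "count (x k) d < count (x k) c" if d: "d \<noteq> c" "d \<notin> past s0 x" and k: "k \<ge> s0" for d k
  proof (cases "d \<in> past k x")
    case False
    then have "count (x k) d = 0" by (auto simp: past_def not_in_iff)
    then show ?thesis using s0(3)[OF k] by linarith
  next
    case True
    \<comment> \<open>The birth time of d. It comes after s0, so at step s the colour d is new,
      exactly the situation covered by the hypothesis \<open>catch\<close>.\<close>
    define t where "t = (LEAST t. d \<in> past t x)"
    have t: "d \<in> past t x" "t \<le> k" unfolding t_def using True by (auto intro: LeastI Least_le)
    have "\<not> t \<le> s0" using t(1) d(2) past_mono[of t s0 x] by auto
    then obtain s where s: "t = Suc s" "s \<ge> s0" by (cases t) auto
    have new: "d \<notin> past s x" using not_less_Least[of s "\<lambda>t. d \<in> past t x"] s unfolding t_def by simp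
    then have mem: "d \<in># x (Suc s)" using t(1) unfolding s(1) past_def by (auto simp: le_Suc_eq)
    have gr: "(real s + 2) powr growth / real (Suc j) \<le> real (count (x (Suc s)) c)"
      using grow[of "Suc s"] s(2) s0(1) by (simp add: add_ac)
    have neq: "count (x i) c \<noteq> count (x i) d" if "i \<ge> Suc s" for i
      using catch[of s d i, OF _ gr d(1) new mem that] s(2) s0(2) by (auto simp: meets_def)
    have "c \<in> past (Suc s) x"
      using alive[of "Suc s"] s(2) s0(1) by (auto simp: past_def)
    moreover have "d \<in> past (Suc s) x" using mem by (auto simp: past_def)
    moreover have "count (x (Suc s)) d < count (x (Suc s)) c"
    proof -
      obtain c' where "c' \<in># x s" and "x (Suc s) = x s + {#c'#}
          \<or> (\<exists>d. d \<notin> past s x \<and> x (Suc s) = x s - {#c'#} + {#d#})"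
        using valid[of s] unfolding valid_step_def by blast
      moreover have "count (x s) d = 0" using new by (auto simp: past_def not_in_iff)
      ultimately have "count (x (Suc s)) d \<le> 1" by auto
      moreover have "threshold < count (x (Suc s)) c" using s(2) by (intro s0(3)) auto
      ultimately show ?thesis using threshold_ge(1) by simp
    qed
    ultimately show ?thesis using t(2) neq s(1)
      by (intro count_order_preserved[of x c "Suc s" d k] valid) auto
  qed
  define lt where "lt a b \<longleftrightarrow> eventually (\<lambda>k. count (x k) a < count (x k) b) sequentially" for a b
  have lt_trans: "lt a d" if "lt a b" "lt b d" for a b d
    using that unfolding lt_def by eventually_elim simp
  \<comment> \<open>Ties are controlled only for large totals; the condition \<open>big\<close>
    forces the total of the pair to infinity.\<close>
  have comparable: "lt a b \<or> lt b a"
    if ab: "a \<noteq> b" "a \<in> past s0 x" "b \<in> past s0 x" and big: "a = c \<or> lt c a \<or> b = c" for a b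
  proof -
    have large: "eventually (\<lambda>k. N \<le> count (x k) a + count (x k) b) sequentially" for N
      using big
    proof (elim disjE)
      assume "lt c a"
      then show ?thesis using unb[of N] unfolding lt_def by eventually_elim simp
    qed (use unb[of N] in \<open>auto elim: eventually_mono\<close>)
    obtain k1 where k1: "\<And>k. k \<ge> k1 \<Longrightarrow> Suc threshold \<le> count (x k) a + count (x k) b"
      using large[of "Suc threshold"] by (auto simp: eventually_sequentially)
    have "a \<in> past (max k1 s0) x" "b \<in> past (max k1 s0) x"
      using ab past_mono[of s0 "max k1 s0" x] by auto
    moreover have "\<forall>k\<ge>max k1 s0. threshold < count (x k) a + count (x k) b"
      using k1 by (simp add: Suc_le_eq)
    ultimately obtain N where N: "\<And>k. k \<ge> max k1 s0 \<Longrightarrow> count (x k) a = count (x k) b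
        \<Longrightarrow> count (x k) a + count (x k) b < N"
      using ties[OF ab(1)] by blast
    obtain k2 where k2: "\<And>k. k \<ge> k2 \<Longrightarrow> N \<le> count (x k) a + count (x k) b"
      using large[of N] by (auto simp: eventually_sequentially)
    \<comment> \<open>After k2 the totals are at least N, whereas tied totals are below N. Hence no
      tie occurs from n on, and the order at n is final.\<close>
    define n where "n = max k2 (max k1 s0)"
    have neq: "count (x k) a \<noteq> count (x k) b" if "k \<ge> n" for k
      using N[of k] k2[of k] that unfolding n_def by fastforce
    have "s0 \<le> n" by (simp add: n_def)
    then have old: "a \<in> past n x" "b \<in> past n x"
      using ab past_mono[of s0 n x] by auto
    consider "count (x n) a < count (x n) b" | "count (x n) b < count (x n) a"
      using neq[of n] by linarith
    then show ?thesis
    proof cases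
      case 1
      then have "\<forall>k\<ge>n. count (x k) a < count (x k) b"
        using count_order_preserved[of x b n a, OF valid old(2,1)] neq by metis
      then show ?thesis unfolding lt_def eventually_sequentially by blast
    next
      case 2
      then have "\<forall>k\<ge>n. count (x k) b < count (x k) a"
        using count_order_preserved[of x a n b, OF valid old] neq by metis
      then show ?thesis unfolding lt_def eventually_sequentially by blast
    qed
  qed
  have fin: "finite (past s0 x)" by (simp add: past_def)
  have c_past: "c \<in> past s0 x" using alive[of s0] s0(1) by (auto simp: past_def)
  \<comment> \<open>Old colours outside G need not be comparable with each other, but each is
    comparable with c and thus eventually below it.\<close>
  define G where "G = {a \<in> past s0 x. a = c \<or> lt c a}"
  have "\<exists>g\<in>G. \<forall>e\<in>G. e \<noteq> g \<longrightarrow> lt e g"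
  proof (rule ex_greatest_of_total)
    show "finite G" "G \<noteq> {}" using fin c_past by (auto simp: G_def)
    show "lt a b \<or> lt b a" if "a \<in> G" "b \<in> G" "a \<noteq> b" for a b
      using that by (intro comparable) (auto simp: G_def)
  qed (rule lt_trans)
  then obtain g where g: "g \<in> G" "\<And>e. e \<in> G \<Longrightarrow> e \<noteq> g \<Longrightarrow> lt e g" by blast
  have c_le_g: "c = g \<or> lt c g" using g(1) by (auto simp: G_def)
  have early: "lt e g" if "e \<in> past s0 x" "e \<noteq> g" for e
  proof (cases "e \<in> G")
    case True
    then show ?thesis using g(2) that by simp
  next
    case False
    then have "lt e c" using that comparable[of e c] c_past by (auto simp: G_def)
    then show ?thesis using c_le_g lt_trans by blast
  qed
  have "eventually (\<lambda>k. \<forall>e\<in>past s0 x - {g}. count (x k) e < count (x k) g) sequentially"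
    using early fin unfolding lt_def by (intro eventually_ball_finite) auto
  moreover have "eventually (\<lambda>k. count (x k) c \<le> count (x k) g) sequentially"
    using c_le_g unfolding lt_def by (auto elim: eventually_mono)
  ultimately have "eventually (\<lambda>k. has_most_balls g (x k)) sequentially"
    using eventually_ge_at_top[of s0]
  proof eventually_elim
    case (elim k)
    show ?case unfolding has_most_balls_def
    proof (intro allI impI)
      fix d assume "d \<noteq> g"
      show "count (x k) d < count (x k) g"
      proof (cases "d \<in> past s0 x")
        case True
        then show ?thesis using elim(1) \<open>d \<noteq> g\<close> by simp
      next
        case False
        then have "d \<noteq> c" using c_past by auto
        then show ?thesis using late[OF _ False elim(3)] elim(2) by simp
      qed
    qed
  qed
  then show ?thesis by (auto simp: eventually_sequentially)
qed

lemma AE_dominating: "AE w in M. \<exists>c n0. \<forall>n\<ge>n0. has_most_balls c (U n w)"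
  using AE_space AE_valid_path AE_survivor AE_growth AE_large_ties AE_eventually_no_catch
proof eventually_elim
  case (elim w)
  from elim(3) obtain c m where alive: "\<forall>k\<ge>m. c \<in># U k w" by blast
  with elim(4) obtain j where
    j: "\<forall>k\<ge>m. (real k + 1) powr growth / real (Suc j) \<le> real (count (U k w) c)" by blast
  from elim(6) obtain s1 where s1: "\<forall>s\<ge>s1. w \<notin> catch c j s" by blast
  show ?case
  proof (rule dominating_if_path_properties[where c = c and j = j and m = m and ?s1.0 = s1])
    show "U k w \<notin> meets c d"
      if "s \<ge> s1" "(real s + 2) powr growth / real (Suc j) \<le> real (count (U (Suc s) w) c)"
        "d \<noteq> c" "d \<notin> past s (\<lambda>n. U n w)" "d \<in># U (Suc s) w" "k \<ge> Suc s" for s d k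
      using s1 that elim(1) unfolding catch_def by blast
  qed (use elim(2,5) alive j in blast)+
qed

end

theorem theorem2p10:
  fixes M :: "'w measure" and p :: real
    and U :: "nat \<Rightarrow> 'w \<Rightarrow> 'c::countable multiset"
  assumes "1 / 2 < p" and "p < 1"
    and "infinite_colour_urn M p U"
  shows "AE w in M. \<exists>c n0. \<forall>n\<ge>n0. has_most_balls c (U n w)"
proof -
  interpret supercritical_urn M p U
    using assms by (simp add: supercritical_urn_def supercritical_urn_axioms_def)
  show ?thesis by (rule AE_dominating)
qed

end
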